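(* Let $\mathcal{G}$ be a minor-closed class of vertex coloured ribbon graphs (closed under deletion and contraction). Then there is a unique map $U:\mathcal{G}\to\mathbb{Z}[\alpha,\gamma,a_{\mathrm{bs}},a_{\mathrm{bp}}^{1/2},a_{\mathrm{ol}}^{1/2},b_{\mathrm{bs}},b_{\mathrm{bp}}^{1/2},b_{\mathrm{ol}}^{1/2}]$ such that $U(\mathbb{G})=a_iU(\mathbb{G}\backslash e)+b_jU(\mathbb{G}/e)$ whenever $e$ is an edge of $\mathbb{G}$ of type $(i,j)$, and $U(\mathbb{G})=\alpha^n\gamma^v$ whenever $\mathbb{G}$ is edgeless with $v$ vertices and $n$ vertex colour classes, where $a_{\mathrm{nl}}=a_{\mathrm{bp}}^{1/2}a_{\mathrm{ol}}^{1/2}$ and $b_{\mathrm{nl}}=b_{\mathrm{bp}}^{1/2}b_{\mathrm{ol}}^{1/2}$. Moreover, $$U(\mathbb{G})=\alpha^{k(\mathbb{G}/\mathcal{V})}\gamma^{v(\mathbb{G})-\rho(\mathbb{G})}b_{\mathrm{bs}}^{r_1(\mathbb{G})}b_{\mathrm{bp}}^{r_2(\mathbb{G})}a_{\mathrm{ol}}^{|E|-\rho(\mathbb{G})}\sum_{A\subseteq E}\Big(\frac{\alpha\gamma a_{\mathrm{bs}}}{b_{\mathrm{bs}}}\Big)^{r_1(\mathbb{G})-r_1(A)}\Big(\frac{\gamma a_{\mathrm{bp}}}{b_{\mathrm{bp}}}\Big)^{r_2(\mathbb{G})-r_2(A)}\Big(\frac{\gamma b_{\mathrm{ol}}}{a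_{\mathrm{ol}}}\Big)^{|A|-\rho(A)}.$$
   Context: A ribbon graph $\mathbb{G}=(V,E)$ is a surface with boundary represented as a union of two finite sets of closed discs, vertices and edges, meeting in disjoint line segments, each on the boundary of exactly one vertex and one edge, each edge containing exactly two such segments. A loop is an edge meeting one vertex; non-orientable if its union with its vertex is a Möbius band, orientable otherwise. Deletion $\mathbb{G}\backslash e$ removes $e$; contraction $\mathbb{G}/e$ glues a disc (new vertex) along each boundary component of $e\cup u\cup v$ ($u,v$ the ends of $e$) and removes $e,u,v$ (non-loop: ends merge into one vertex; non-orientable loop: one new vertex; orientable loop: two new vertices). $e^c=E\setminus\{e\}$. A vertex coloured ribbon graph has a partition $\mathcal{V}$ of $V$ into vertex colour classes (up to equivalences preserving it). Deletion leaves classes unchanged. Contraction of $e$: if distinct ends $u,v$ merge into $p$, the classes of $u,v$ merge into the single class $([u]\cup[v]\cup\{p\})\setminus\{u,v\}$; if $e$ is a non-orientable loop at $u$ producing $p$, $p$ replaces $u$ in its class; if $e$ is an orientable loop at $u$ producing $p,q$, both replace $u$ in its class; other vertices keep their classes. Edge types: $\mathrm{bs}$ = one edge joining two distinct vertices in different vertex colour classes; $\mathrm{bp}$ = one edge joining two distinct vertices of the same class; $\mathrm{ol}$ = one vertex with an orientable loop; $\mathrm{nl}$ = one vertex with a non-orientable loop. Edge $e$ is of type $(i,j)$ if after removing isolated vertices $\mathbb{G}/e^c=i$ and $\mathbb{G}\backslash e^c=j$. Parameters: $v(\mathbb{G})=|V|$; $b(A)$ = number of boundary components of ribbon subgraph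 $(V,A)$; $\rho(A)=\frac12(|A|+|V|-b(A))$, $\rho(\mathbb{G})=\rho(E)$. $\mathbb{G}/\mathcal{V}$ is the graph on the vertex colour classes with one edge for each edge of $\mathbb{G}$ joining the classes of its ends; $k$ denotes number of components and $r_H(A)$ the rank of the spanning subgraph of graph $H$ with edges $A$. $r_1(A)=r_{\mathbb{G}/\mathcal{V}}(A)$, $r_2(A)=\rho(A)-r_{\mathbb{G}/\mathcal{V}}(A)$, $r_i(\mathbb{G})=r_i(E)$. *)

theory Defs
  imports Complex_Main "HOL-Library.Poly_Mapping" "HOL-Library.Disjoint_Sets"
    "HOL-Library.FuncSet" "HOL-Library.Infinite_Typeclass"
begin

section \<open>Vertex coloured ribbon graphs\<close>

text \<open>
  A ribbon graph is encoded by the way its discs are glued together.  An edge disc \<open>e\<close> is a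
  rectangle with four corners \<open>(e, i, s)\<close>: the bit \<open>i\<close> says on which of its two end segments (the
  segments shared with vertices) the corner lies, and \<open>s\<close> says on which of its two free sides.
  So \<open>seg\<close> moves along an end segment and \<open>side\<close> along a free side of the edge.  The boundary
  circle of a vertex disc meeting at least one edge consists alternately of end segments and of free
  arcs; each free arc joins two corners, and \<open>arc\<close> interchanges these.  A vertex that meets no edge
  has no corners and occurs only in \<open>verts\<close>.  The field \<open>vtx\<close> gives the vertex disc on
  which a corner lies, and \<open>classes\<close> is the partition into vertex colour classes.
\<close>

type_synonym 'e corner = "'e \<times> bool \<times> bool"

fun seg :: "'e corner \<Rightarrow> 'e corner" where
  "seg (e, i, s) = (e, i, \<not> s)"

fun side :: "'e corner \<Rightarrow> 'e corner" where
  "side (e, i, s) = (e, \<not> i, s)"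

record ('v, 'e) vcrg =
  verts :: "'v set"
  edges :: "'e set"
  vtx :: "'e corner \<Rightarrow> 'v"
  arc :: "'e corner \<Rightarrow> 'e corner"
  classes :: "'v set set"

definition corners :: "('v, 'e) vcrg \<Rightarrow> 'e corner set" where
  "corners G = edges G \<times> UNIV"

definition ends :: "('v, 'e) vcrg \<Rightarrow> 'e \<Rightarrow> 'v set" where
  "ends G e = vtx G ` ({e} \<times> UNIV)"

text \<open>
  The boundary of the ribbon subgraph \<open>(V, A)\<close> runs along the free arcs of the vertices, the free
  sides of the edges in \<open>A\<close>, and those segments at which an edge not in \<open>A\<close> was attached.  Its
  components are the classes of the following relation on corners, together with the boundaries of
  the vertices that meet no edge of \<open>G\<close>.  In particular, \<open>boundary_rel G {}\<close> walks along the
  boundary circles of the vertex discs.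
\<close>

definition boundary_rel :: "('v, 'e) vcrg \<Rightarrow> 'e set \<Rightarrow> ('e corner \<times> 'e corner) set" where
  "boundary_rel G A =
     {(f, g). g = arc G f \<or> g = (if fst f \<in> A then side f else seg f)}\<^sup>*"

definition ribbon_graph :: "('v, 'e) vcrg \<Rightarrow> bool" where
  "ribbon_graph G \<longleftrightarrow>
     finite (verts G) \<and> finite (edges G) \<and>
     (\<forall>f \<in> corners G.
        arc G f \<in> corners G \<and> arc G f \<noteq> f \<and> arc G (arc G f) = f \<and>
        vtx G f \<in> verts G \<and> vtx G (arc G f) = vtx G f \<and> vtx G (seg f) = vtx G f) \<and>
     (\<forall>f \<in> corners G. \<forall>g \<in> corners G. vtx G f = vtx G g \<longrightarrow> (f, g) \<in> boundary_rel G {})"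

definition vc_ribbon_graph :: "('v, 'e) vcrg \<Rightarrow> bool" where
  "vc_ribbon_graph G \<longleftrightarrow> ribbon_graph G \<and> partition_on (verts G) (classes G)"

text \<open>
  Homeomorphisms preserving vertex discs, edge discs and colour classes.  The bijection of the
  edges is induced by \<open>\<phi>\<close>, because \<open>\<phi>\<close> commutes with \<open>seg\<close> and \<open>side\<close>.
\<close>

definition equivalent :: "('v, 'e) vcrg \<Rightarrow> ('v, 'e) vcrg \<Rightarrow> bool" where
  "equivalent G H \<longleftrightarrow>
     (\<exists>\<phi> \<psi>. bij_betw \<phi> (corners G) (corners H) \<and> bij_betw \<psi> (verts G) (verts H) \<and>
        (\<forall>f \<in> corners G. \<phi> (seg f) = seg (\<phi> f) \<and> \<phi> (side f) = side (\<phi> f) \<and>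
           \<phi> (arc G f) = arc H (\<phi> f) \<and> \<psi> (vtx G f) = vtx H (\<phi> f)) \<and>
        (\<lambda>C. \<psi> ` C) ` classes G = classes H)"

definition isolated :: "('v, 'e) vcrg \<Rightarrow> 'v set" where
  "isolated G = verts G - vtx G ` corners G"

definition remove_isolated :: "('v, 'e) vcrg \<Rightarrow> ('v, 'e) vcrg" where
  "remove_isolated G =
     G\<lparr>verts := verts G - isolated G, classes := (\<lambda>C. C - isolated G) ` classes G - {{}}\<rparr>"


section \<open>Deletion and contraction\<close>

text \<open>
  When \<open>e\<close> disappears, a free arc that ran into a corner of \<open>e\<close> continues along the end segment
  of \<open>e\<close> (deletion, \<open>t = seg\<close>) or along the free side of \<open>e\<close> (contraction, \<open>t = side\<close>), and
  then along the next arc.  As \<open>e\<close> has just two end segments and two free sides, this happens at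
  most twice in a row.
\<close>

definition reroute ::
    "('v, 'e) vcrg \<Rightarrow> ('e corner \<Rightarrow> 'e corner) \<Rightarrow> 'e \<Rightarrow> 'e corner \<Rightarrow> 'e corner" where
  "reroute G t e f =
     (let step = (\<lambda>g. if fst g = e then arc G (t g) else g) in step (step (arc G f)))"

definition delete :: "'e \<Rightarrow> ('v, 'e) vcrg \<Rightarrow> ('v, 'e) vcrg" where
  "delete e G = G\<lparr>edges := edges G - {e}, arc := reroute G seg e\<rparr>"

text \<open>
  The boundary components of the union of \<open>e\<close> and its ends; contraction glues a disc, i.e. a new
  vertex, along each of them.
\<close>

definition contraction_circles :: "('v, 'e) vcrg \<Rightarrow> 'e \<Rightarrow> 'e corner set set" where
  "contraction_circles G e = {f \<in> corners G. vtx G f \<in> ends G e} // boundary_rel G {e}"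

text \<open>
  Names for the new vertices, distinct from those of the surviving vertices.  The choice does not
  matter up to equivalence; it is possible because the type of vertex names is infinite.
\<close>

definition new_vertex ::
    "('v :: infinite, 'e) vcrg \<Rightarrow> 'e \<Rightarrow> 'e corner set \<Rightarrow> 'v" where
  "new_vertex G e =
     (SOME \<nu>. inj_on \<nu> (contraction_circles G e) \<and>
        \<nu> ` contraction_circles G e \<inter> (verts G - ends G e) = {})"

text \<open>
  In \<open>classes\<close> below, the classes meeting \<open>ends G e\<close> (two or one of them) are merged, and the
  ends are replaced by the new vertices.  This comprises all three cases: \<open>e\<close> not a loop,
  \<open>e\<close> a non-orientable loop (one new vertex) and \<open>e\<close> an orientable loop (two new vertices).
\<close>

definition contract :: "'e \<Rightarrow> ('v :: infinite, 'e) vcrg \<Rightarrow> ('v, 'e) vcrg" where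
  "contract e G =
     (let new = new_vertex G e ` contraction_circles G e in
      \<lparr>verts = (verts G - ends G e) \<union> new,
       edges = edges G - {e},
       vtx = (\<lambda>f. if vtx G f \<in> ends G e then new_vertex G e (boundary_rel G {e} `` {f})
                  else vtx G f),
       arc = reroute G side e,
       classes = {C \<in> classes G. C \<inter> ends G e = {}} \<union>
                 {(\<Union>{C \<in> classes G. C \<inter> ends G e \<noteq> {}} - ends G e) \<union> new}\<rparr>)"

text \<open>
  Deletion and contraction of a finite set of edges, one after the other.  Up to equivalence the
  result does not depend on the order.
\<close>

definition enumeration :: "'a set \<Rightarrow> 'a list" where
  "enumeration A = (SOME xs. distinct xs \<and> set xs = A)"

definition delete_set :: "'e set \<Rightarrow> ('v, 'e) vcrg \<Rightarrow> ('v, 'e) vcrg" where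
  "delete_set A G = fold delete (enumeration A) G"

definition contract_set :: "'e set \<Rightarrow> ('v :: infinite, 'e) vcrg \<Rightarrow> ('v, 'e) vcrg" where
  "contract_set A G = fold contract (enumeration A) G"

text \<open>As ribbon graphs are considered up to equivalence, classes are closed under it.\<close>

definition minor_closed_class :: "('v :: infinite, 'e) vcrg set \<Rightarrow> bool" where
  "minor_closed_class \<G> \<longleftrightarrow>
     (\<forall>G \<in> \<G>. vc_ribbon_graph G) \<and>
     (\<forall>G \<in> \<G>. \<forall>H. vc_ribbon_graph H \<and> equivalent G H \<longrightarrow> H \<in> \<G>) \<and>
     (\<forall>G \<in> \<G>. \<forall>e \<in> edges G. delete e G \<in> \<G> \<and> contract e G \<in> \<G>)"


section \<open>Edge types\<close>

datatype edge_type = BS | BP | OL | NL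

text \<open>
  The union of a loop \<open>e\<close> with its vertex disc is orientable (hence an annulus, not a Moebius band)
  iff the two discs can be oriented compatibly, i.e. such that their boundary orientations are
  opposite on the segments they share.  Such an orientation is recorded by marking, on each shared
  segment, the corner at which it starts when the boundary of the vertex is traversed.  Traversing
  the vertex boundary, the marks alternate along segments and free arcs; the edge boundary traverses
  its end segments backwards, so the marks alternate along its free sides as well.
\<close>

definition orientable_loop :: "('v, 'e) vcrg \<Rightarrow> 'e \<Rightarrow> bool" where
  "orientable_loop G e \<longleftrightarrow>
     card (ends G e) = 1 \<and>
     (\<exists>\<omega> :: 'e corner \<Rightarrow> bool.
        (\<forall>f \<in> corners G. vtx G f \<in> ends G e \<longrightarrow> \<omega> (arc G f) \<noteq> \<omega> f \<and> \<omega> (seg f) \<noteq> \<omega> f) \<and>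
        (\<forall>f \<in> {e} \<times> UNIV. \<omega> (side f) \<noteq> \<omega> f))"

definition nonorientable_loop :: "('v, 'e) vcrg \<Rightarrow> 'e \<Rightarrow> bool" where
  "nonorientable_loop G e \<longleftrightarrow> card (ends G e) = 1 \<and> \<not> orientable_loop G e"

fun has_shape :: "('v, 'e) vcrg \<Rightarrow> edge_type \<Rightarrow> bool" where
  "has_shape G BS \<longleftrightarrow>
     (\<exists>e u v. u \<noteq> v \<and> edges G = {e} \<and> verts G = {u, v} \<and> ends G e = {u, v} \<and>
        classes G = {{u}, {v}})"
| "has_shape G BP \<longleftrightarrow>
     (\<exists>e u v. u \<noteq> v \<and> edges G = {e} \<and> verts G = {u, v} \<and> ends G e = {u, v} \<and>
        classes G = {{u, v}})"
| "has_shape G OL \<longleftrightarrow>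
     (\<exists>e u. edges G = {e} \<and> verts G = {u} \<and> orientable_loop G e)"
| "has_shape G NL \<longleftrightarrow>
     (\<exists>e u. edges G = {e} \<and> verts G = {u} \<and> nonorientable_loop G e)"

definition has_type ::
    "('v :: infinite, 'e) vcrg \<Rightarrow> 'e \<Rightarrow> edge_type \<Rightarrow> edge_type \<Rightarrow> bool" where
  "has_type G e i j \<longleftrightarrow>
     has_shape (remove_isolated (contract_set (edges G - {e}) G)) i \<and>
     has_shape (remove_isolated (delete_set (edges G - {e}) G)) j"


section \<open>Parameters\<close>

definition num_boundary :: "('v, 'e) vcrg \<Rightarrow> 'e set \<Rightarrow> nat" where
  "num_boundary G A = card (corners G // boundary_rel G A) + card (isolated G)"

definition rho :: "('v, 'e) vcrg \<Rightarrow> 'e set \<Rightarrow> rat" where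
  "rho G A = (of_nat (card A) + of_nat (card (verts G)) - of_nat (num_boundary G A)) / 2"

record ('n, 'e) multigraph =
  nodes :: "'n set"
  links :: "'e set"
  link_ends :: "'e \<Rightarrow> 'n set"

definition num_components :: "('n, 'e) multigraph \<Rightarrow> 'e set \<Rightarrow> nat" where
  "num_components H A = card (nodes H // {(x, y). \<exists>e \<in> A. link_ends H e = {x, y}}\<^sup>*)"

definition graph_rank :: "('n, 'e) multigraph \<Rightarrow> 'e set \<Rightarrow> rat" where
  "graph_rank H A = of_nat (card (nodes H)) - of_nat (num_components H A)"

definition class_of :: "('v, 'e) vcrg \<Rightarrow> 'v \<Rightarrow> 'v set" where
  "class_of G x = (THE C. C \<in> classes G \<and> x \<in> C)"

definition class_graph :: "('v, 'e) vcrg \<Rightarrow> ('v set, 'e) multigraph" where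
  "class_graph G =
     \<lparr>nodes = classes G, links = edges G, link_ends = (\<lambda>e. class_of G ` ends G e)\<rparr>"

definition r1 :: "('v, 'e) vcrg \<Rightarrow> 'e set \<Rightarrow> rat" where
  "r1 G A = graph_rank (class_graph G) A"

definition r2 :: "('v, 'e) vcrg \<Rightarrow> 'e set \<Rightarrow> rat" where
  "r2 G A = rho G A - r1 G A"


section \<open>The coefficient ring\<close>

text \<open>
  The half-integral and negative exponents in the state sum live in the ring of integer Laurent
  polynomials with rational exponents (in fact half-integers suffice), of which
  \<open>\<int>[\<alpha>, \<gamma>, a\<^sub>b\<^sub>s, a\<^sub>b\<^sub>p\<^bsup>1/2\<^esup>, a\<^sub>o\<^sub>l\<^bsup>1/2\<^esup>, b\<^sub>b\<^sub>s, b\<^sub>b\<^sub>p\<^bsup>1/2\<^esup>, b\<^sub>o\<^sub>l\<^bsup>1/2\<^esup>]\<close> is the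
  subring \<open>coeff_ring\<close>.
\<close>

datatype var = Alpha | Gamma | A_bs | A_bp | A_ol | B_bs | B_bp | B_ol

type_synonym laurent = "(var \<Rightarrow>\<^sub>0 rat) \<Rightarrow>\<^sub>0 int"

definition X :: "var \<Rightarrow> laurent" where
  "X x = Poly_Mapping.single (Poly_Mapping.single x 1) 1"

definition coeff_ring :: "laurent set" where
  "coeff_ring =
     {p. \<forall>m \<in> Poly_Mapping.keys p.
        (\<forall>x \<in> {Alpha, Gamma, A_bs, B_bs}. Poly_Mapping.lookup m x \<in> \<nat>) \<and>
        (\<forall>x \<in> {A_bp, A_ol, B_bp, B_ol}. 2 * Poly_Mapping.lookup m x \<in> \<nat>)}"

text \<open>
  Rational powers of monomials (with coefficient 1); only used for such arguments, whose set of
  keys is a singleton.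
\<close>

definition mpow :: "laurent \<Rightarrow> rat \<Rightarrow> laurent" (infixr \<open>powq\<close> 80) where
  "p powq q =
     Poly_Mapping.single
       (Poly_Mapping.map (\<lambda>c. q * c) (the_elem (Poly_Mapping.keys p))) 1"

definition mdivide :: "laurent \<Rightarrow> laurent \<Rightarrow> laurent" (infixl \<open>divm\<close> 70) where
  "p divm m = p * m powq (-1)"

fun acoeff :: "edge_type \<Rightarrow> laurent" where
  "acoeff BS = X A_bs"
| "acoeff BP = X A_bp"
| "acoeff OL = X A_ol"
| "acoeff NL = X A_bp powq (1/2) * X A_ol powq (1/2)"

fun bcoeff :: "edge_type \<Rightarrow> laurent" where
  "bcoeff BS = X B_bs"
| "bcoeff BP = X B_bp"
| "bcoeff OL = X B_ol"
| "bcoeff NL = X B_bp powq (1/2) * X B_ol powq (1/2)"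

text \<open>
  Maps on \<open>\<G>\<close> with values in the coefficient ring, well defined on equivalence classes, that
  satisfy the recursion and the initial conditions.  Outside \<open>\<G>\<close> such a map is \<open>undefined\<close> by
  the convention of \<open>\<rightarrow>\<^sub>E\<close>, so that uniqueness refers to its values on \<open>\<G>\<close> only.
\<close>

definition deletion_contraction_map ::
    "('v :: infinite, 'e) vcrg set \<Rightarrow> (('v, 'e) vcrg \<Rightarrow> laurent) \<Rightarrow> bool" where
  "deletion_contraction_map \<G> U \<longleftrightarrow>
     U \<in> \<G> \<rightarrow>\<^sub>E coeff_ring \<and>
     (\<forall>G \<in> \<G>. \<forall>H \<in> \<G>. equivalent G H \<longrightarrow> U G = U H) \<and>
     (\<forall>G \<in> \<G>. \<forall>e \<in> edges G. \<forall>i j. has_type G e i j \<longrightarrow>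
        U G = acoeff i * U (delete e G) + bcoeff j * U (contract e G)) \<and>
     (\<forall>G \<in> \<G>. edges G = {} \<longrightarrow>
        U G = X Alpha ^ card (classes G) * X Gamma ^ card (verts G))"

definition state_sum :: "('v, 'e) vcrg \<Rightarrow> laurent" where
  "state_sum G =
     (let E = edges G; \<alpha> = X Alpha; \<gamma> = X Gamma in
      \<alpha> ^ num_components (class_graph G) E * \<gamma> powq (of_nat (card (verts G)) - rho G E) *
      bcoeff BS powq r1 G E * bcoeff BP powq r2 G E * acoeff OL powq (of_nat (card E) - rho G E) *
      (\<Sum>A \<in> Pow E.
         (\<alpha> * \<gamma> * acoeff BS divm bcoeff BS) powq (r1 G E - r1 G A) *
         (\<gamma> * acoeff BP divm bcoeff BP) powq (r2 G E - r2 G A) *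
         (\<gamma> * bcoeff OL divm acoeff OL) powq (of_nat (card A) - rho G A)))"

end

theory Submission
  imports Defs
begin

text \<open>
  After cancellation the summand of the state sum for \<open>A\<close> is a monomial in which \<open>\<alpha>\<close> has exponent
  \<open>k(A)\<close> and \<open>\<gamma>\<close> has exponent \<open>b(A)\<close>.  Deleting \<open>e\<close> preserves \<open>b(A)\<close> and \<open>k(A)\<close> for
  \<open>e \<notin> A\<close>, and contracting \<open>e\<close> turns \<open>b(A \<union> {e})\<close> and \<open>k(A \<union> {e})\<close> into \<open>b(A)\<close> and \<open>k(A)\<close>.
  Since \<open>|V| = b(\<emptyset>)\<close> and the number of classes is \<open>k(\<emptyset>)\<close>, this determines \<open>\<rho>\<close>, \<open>r\<^sub>1\<close> and
  \<open>r\<^sub>2\<close> of all minors; in particular the type \<open>(i, j)\<close> of \<open>e\<close> records the increments of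
  \<open>(\<rho>, r\<^sub>1)\<close> from \<open>E - {e}\<close> to \<open>E\<close> and from \<open>\<emptyset>\<close> to \<open>{e}\<close>.  Splitting the sum according to
  whether \<open>e \<in> A\<close> therefore gives the recursion.  Every edge has a type, so the recursion determines
  the map by induction on the number of edges, and also shows that its values lie in the
  coefficient ring.
\<close>

section \<open>Orbits of pairs of involutions\<close>

text \<open>The number b(A) counts orbits of two involutions on corners, together with the isolated
  vertices. A minor keeps the corners off e but has a rerouted \<open>arc\<close>. Orbits that leave
  the four corners of e survive; an orbit confined to these corners vanishes and comes back as an
  isolated vertex of the minor, so that the two terms of \<open>num_boundary\<close> balance. That
  \<open>delete e G\<close> and \<open>contract e G\<close> are ribbon graphs again, in particular
  that the rerouted \<open>arc\<close> is an involution, is supplied by the class, all of whose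
  members satisfy \<open>vc_ribbon_graph\<close>. The square roots in a_nl and b_nl come from the
  value 1/2 of rho on a non-orientable loop: for all four types the coefficient is a_bs^r1 *
  a_bp^(rho - r1) * a_ol^(1 - rho), evaluated on the graph with that single edge, and likewise for
  b. This uniform shape makes the recursion hold for each summand separately.\<close>

lemma card_image_eq_if_same_kernel:
  assumes "\<And>x y. x \<in> S \<Longrightarrow> y \<in> S \<Longrightarrow> g x = g y \<longleftrightarrow> h x = h y"
  shows "card (g ` S) = card (h ` S)"
proof -
  let ?k = "\<lambda>z. h (inv_into S g z)"
  have k: "?k (g x) = h x" if "x \<in> S" for x
    using that assms[of "inv_into S g (g x)" x]
    by (simp add: f_inv_into_f inv_into_into)
  have "inj_on ?k (g ` S)"
    using assms by (auto simp: inj_on_def k)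
  moreover have "?k ` g ` S = h ` S"
    using k by (force simp: image_iff)
  ultimately show ?thesis
    by (metis card_image)
qed

lemma quotient_eq_image: "S // r = (\<lambda>x. r `` {x}) ` S"
  by (auto simp: quotient_def)

lemma card_quotient_eq:
  assumes "\<And>x y. x \<in> S \<Longrightarrow> y \<in> S \<Longrightarrow> r `` {x} = r `` {y} \<longleftrightarrow> s `` {h x} = s `` {h y}"
  shows "card (S // r) = card ((h ` S) // s)"
  unfolding quotient_eq_image image_image
  by (rule card_image_eq_if_same_kernel) (fact assms)

text \<open>The common induction behind all statements about walks. With \<open>h = id\<close> it
  shows that a walk stays in \<open>S\<close>; with \<open>Q = {}\<close> it shows that
  \<open>h\<close> is constant along a walk; otherwise it carries a walk over to another
  graph.\<close>

lemma rtrancl_map: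
  assumes "(x, y) \<in> R\<^sup>*" "x \<in> S"
    and "\<And>u v. u \<in> S \<Longrightarrow> (u, v) \<in> R \<Longrightarrow> v \<in> S \<and> (h u, h v) \<in> Q\<^sup>*"
  shows "y \<in> S \<and> (h x, h y) \<in> Q\<^sup>*"
  using assms(1)
proof (induction rule: rtrancl_induct)
  case (step y z)
  then show ?case
    using assms(3) by (meson rtrancl_trans)
qed (use assms in auto)

text \<open>On a set that it preserves, the closure of a symmetric relation is an equivalence. The
  set \<open>S\<close> is there because \<open>arc G\<close> is known to be an involution on the
  corners of \<open>G\<close> only.\<close>

lemma rtrancl_Image_eq_iff:
  assumes R: "\<And>u v. u \<in> S \<Longrightarrow> (u, v) \<in> R \<Longrightarrow> v \<in> S \<and> (v, u) \<in> R"
    and "x \<in> S" "y \<in> S"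
  shows "R\<^sup>* `` {x} = R\<^sup>* `` {y} \<longleftrightarrow> (x, y) \<in> R\<^sup>*"
proof
  have sym: "(v, u) \<in> R\<^sup>*" if "(u, v) \<in> R\<^sup>*" "u \<in> S" for u v
  proof -
    have "v \<in> S \<and> (v, u) \<in> R\<^sup>*"
      using that(1)
    proof (induction rule: rtrancl_induct)
      case (step v w)
      then show ?case
        using R by (meson converse_rtrancl_into_rtrancl)
    qed (use that in auto)
    then show ?thesis ..
  qed
  assume "(x, y) \<in> R\<^sup>*"
  with sym assms show "R\<^sup>* `` {x} = R\<^sup>* `` {y}"
    by (meson Image_singleton_iff rtrancl_trans subsetI subset_antisym)
qed auto

text \<open>The pattern of \<open>boundary_rel\<close> with arbitrary maps in place of
  \<open>arc\<close> and of the choice between \<open>seg\<close> and \<open>side\<close>, so that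
  one argument serves deletion and contraction.\<close>

definition walk :: "('a \<Rightarrow> 'a) \<Rightarrow> ('a \<Rightarrow> 'a) \<Rightarrow> ('a \<times> 'a) set" where
  "walk a s = {(f, g). g = a f \<or> g = s f}"

text \<open>A walk that never leaves \<open>T\<close> cannot tell \<open>s\<close> from
  \<open>s'\<close>.\<close>

lemma walk_rtrancl_Image_eq:
  assumes "(walk a s)\<^sup>* `` {x} \<subseteq> T" "\<And>f. f \<in> T \<Longrightarrow> s f = s' f"
  shows "(walk a s')\<^sup>* `` {x} = (walk a s)\<^sup>* `` {x}"
proof -
  have sub: "(walk a s2)\<^sup>* `` {x} \<subseteq> (walk a s1)\<^sup>* `` {x}"
    if "(walk a s1)\<^sup>* `` {x} \<subseteq> T" "\<And>f. f \<in> T \<Longrightarrow> s1 f = s2 f" for s1 s2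
  proof -
    have "(x, y) \<in> (walk a s1)\<^sup>*" if "(x, y) \<in> (walk a s2)\<^sup>*" for y
      using that
    proof (induction rule: rtrancl_induct)
      case (step y z)
      then have "y \<in> T"
        using \<open>(walk a s1)\<^sup>* `` {x} \<subseteq> T\<close> by auto
      then have "(y, z) \<in> walk a s1"
        using step(2) \<open>\<And>f. f \<in> T \<Longrightarrow> s1 f = s2 f\<close> by (auto simp: walk_def)
      then show ?case
        using step by simp
    qed simp
    then show ?thesis by auto
  qed
  have "(walk a s')\<^sup>* `` {x} \<subseteq> (walk a s)\<^sup>* `` {x}"
    by (rule sub) (use assms in auto)
  \<comment> \<open>By the inclusion just shown, the orbit for \<open>s'\<close> lies in
    \<open>T\<close> too, so the roles of \<open>s\<close> and \<open>s'\<close> can be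
    exchanged.\<close>
  moreover have "(walk a s)\<^sup>* `` {x} \<subseteq> (walk a s')\<^sup>* `` {x}"
    by (rule sub) (use assms calculation in auto)
  ultimately show ?thesis by auto
qed

text \<open>
  \<open>T\<close> consists of two pairs exchanged by \<open>s\<close>, so a walk entering \<open>T\<close> from outside leaves it after
  at most two detours.
\<close>

lemma walk_bypass:
  assumes a: "\<And>f. f \<in> S \<Longrightarrow> a f \<in> S \<and> a f \<noteq> f \<and> a (a f) = f"
    and s: "\<And>f. f \<in> S \<Longrightarrow> s f \<in> S \<and> s f \<noteq> f \<and> s (s f) = f"
    and T: "T = {p, s p, q, s q}" "T \<subseteq> S"
    and a': "\<And>f. f \<in> S - T \<Longrightarrow> a' f \<in> S - T \<and> a' (a' f) = f"
    and step: "\<And>g. step g = (if g \<in> T then a (s g) else g)"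
    and a'_eq: "\<And>f. f \<in> S - T \<Longrightarrow> a' f = step (step (a f))"
    and fg: "f \<in> S - T" "g \<in> S - T"
  shows "(f, g) \<in> (walk a' s)\<^sup>* \<longleftrightarrow> (f, g) \<in> (walk a s)\<^sup>*"
proof
  have sT: "s h \<in> T \<longleftrightarrow> h \<in> T" if "h \<in> S" for h
  proof -
    have "s (s p) = p" "s (s q) = q"
      using s T by auto
    then have "s k \<in> T" if "k \<in> T" for k
      using that unfolding T(1) by auto
    then show ?thesis
      using s[OF that] by metis
  qed
  \<comment> \<open>Any two elements of \<open>T\<close> from different pairs may serve as
    \<open>p\<close> and \<open>q\<close>.\<close>
  have T_eq: "T = {h, s h, k, s k}" if "h \<in> T" "k \<in> T" "k \<noteq> h" "k \<noteq> s h" for h k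
  proof -
    have "s (s p) = p" "s (s q) = q"
      using s T by auto
    then show ?thesis
      using that unfolding T(1) by auto
  qed
  have w: "(h, step h) \<in> (walk a s)\<^sup>*" for h
  proof -
    have "(h, s h) \<in> walk a s" "(s h, a (s h)) \<in> walk a s"
      by (auto simp: walk_def)
    then have "(h, a (s h)) \<in> (walk a s)\<^sup>*"
      by (meson r_into_rtrancl rtrancl_trans)
    then show ?thesis
      by (simp add: step)
  qed
  have aw: "(h, a h) \<in> (walk a s)\<^sup>*" for h
    by (auto simp: walk_def)
  {
    assume "(f, g) \<in> (walk a' s)\<^sup>*"
    then have "g \<in> S - T \<and> (id f, id g) \<in> (walk a s)\<^sup>*"
    proof (rule rtrancl_map)
      fix u v
      assume u: "u \<in> S - T" and "(u, v) \<in> walk a' s"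
      then consider "v = a' u" | "v = s u"
        by (auto simp: walk_def)
      then show "v \<in> S - T \<and> (id u, id v) \<in> (walk a s)\<^sup>*"
      proof cases
        case 1
        then show ?thesis
          using a'[OF u] a'_eq[OF u] aw w by (metis id_apply rtrancl_trans)
      next
        case 2
        then show ?thesis
          using u s sT by (auto simp: walk_def)
      qed
    qed (use fg in auto)
    then show "(f, g) \<in> (walk a s)\<^sup>*"
      by simp
  }
  \<comment> \<open>Along a walk starting outside \<open>T\<close> the exit \<open>x h\<close> stays outside \<open>T\<close>; an \<open>a\<close>-step, or an
    \<open>s\<close>-step within \<open>T\<close>, replaces it by \<open>a' (x h)\<close>.\<close>
  define x where "x h = step (step h)" for h
  have x_out: "x h = h" if "h \<notin> T" for h
    using that by (simp add: x_def step)
  have x_a: "x (a h) = a' h" if "h \<in> S - T" for h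
    using a'_eq[OF that] by (simp add: x_def)
  \<comment> \<open>Entering \<open>T\<close> at \<open>s h\<close> instead of \<open>h\<close>
    traverses the same detour backwards, so the two exits are the two ends of one rerouted
    arc.\<close>
  have xs: "x (s h) = a' (x h)" if h: "h \<in> T" "x h \<notin> T" for h
  proof -
    have hS: "h \<in> S" using h T by auto
    consider "a h \<notin> T" | "a h \<in> T" "a (s h) \<notin> T" | "a h \<in> T" "a (s h) \<in> T"
      by blast
    then show ?thesis
    proof cases
      case 1
      then have "x (s h) = a h"
        using h hS s sT by (simp add: x_def step)
      moreover have "a' (a h) = x h"
        using x_a[of "a h"] 1 hS a by auto
      ultimately show ?thesis
        using a' 1 a hS by (metis DiffI)
    next
      case 2
      then have "x h = a (s h)"
        using h by (simp add: x_def step)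
      then show ?thesis
        using x_a[of "a (s h)"] 2 a s hS by auto
    next
      \<comment> \<open>Impossible: the walk closes up inside \<open>T\<close>, whether
        \<open>a h = s h\<close> or the two pairs form one cycle. In both situations
        \<open>x h = h\<close>, against the assumption that the exit lies outside
        \<open>T\<close>.\<close>
      case 3
      have xh: "x h = a (s (a (s h)))"
        using 3 h by (simp add: x_def step)
      show ?thesis
      proof (cases "a h = s h")
        case True
        then show ?thesis
          using xh h hS a s by metis
      next
        case False
        then have "T = {h, s h, a h, s (a h)}"
          using T_eq[of h "a h"] h 3 a hS by auto
        then have "a (s h) = s (a h)"
          using 3(2) False a s hS by (metis insertE singletonD)
        then show ?thesis
          using xh h hS a s by metis
      qed
    qed
  qed
  have xa: "x (a h) = a' (x h)" if h: "h \<in> S" "x h \<in> S - T" for h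
  proof -
    consider "h \<notin> T" | "h \<in> T" "a h \<notin> T" | "h \<in> T" "a h \<in> T"
      by blast
    then show ?thesis
    proof cases
      case 1
      then show ?thesis
        using x_a x_out h by auto
    next
      case 2
      then have "a' (a h) = x h"
        using x_a[of "a h"] a h by auto
      then show ?thesis
        using a'[of "a h"] a[OF h(1)] 2 x_out by auto
    next
      \<comment> \<open>The detour uses both pairs. Its walk is \<open>a (s h)\<close>,
        \<open>s h\<close>, \<open>h\<close>, \<open>a h\<close>, \<open>s (a h)\<close>,
        \<open>a (s (a h))\<close>; the first and the last of these are the exits of
        \<open>h\<close> and of \<open>a h\<close>, and \<open>a'\<close> exchanges them. Otherwise
        the walk would close up inside \<open>T\<close>.\<close>
      case 3
      have ne: "a h \<noteq> s h"
      proof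
        assume "a h = s h"
        then have "a (s h) = h"
          using a[OF h(1)] by metis
        then have "x h = h"
          using 3 \<open>a h = s h\<close> by (simp add: x_def step)
        then show False
          using 3 h by auto
      qed
      then have Teq: "T = {h, s h, a h, s (a h)}"
        using T_eq[of h "a h"] h 3 a by auto
      have "a (s h) \<notin> T"
      proof
        assume ash: "a (s h) \<in> T"
        then have "a (s h) = s (a h)"
          using Teq ne a s h(1) by (metis insertE singletonD)
        moreover have "s (s (a h)) = a h" "a (a h) = h"
          using a[OF h(1)] s by auto
        ultimately have "x h = h"
          using 3 ash by (simp add: x_def step)
        then show False
          using 3 h by auto
      qed
      have "x (s h) = a (s (a h))"
        using 3 s[OF h(1)] sT[OF h(1)] by (simp add: x_def step)
      moreover have "x (s h) = a' (x h)"
        using xs h 3 by auto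
      ultimately have *: "a' (x h) = a (s (a h))"
        by simp
      then have "a (s (a h)) \<notin> T"
        using a'[OF h(2)] by auto
      then have "x (a h) = a (s (a h))"
        using 3 by (simp add: x_def step)
      then show ?thesis
        using * by simp
    qed
  qed
  assume "(f, g) \<in> (walk a s)\<^sup>*"
  then have "g \<in> {h \<in> S. x h \<in> S - T} \<and> (x f, x g) \<in> (walk a' s)\<^sup>*"
  proof (rule rtrancl_map)
    fix u v
    assume u: "u \<in> {h \<in> S. x h \<in> S - T}" and "(u, v) \<in> walk a s"
    then have "v = a u \<or> v = s u"
      by (simp add: walk_def)
    then consider "v = a u" | "v = s u" "u \<in> T" | "v = s u" "u \<notin> T"
      by blast
    then show "v \<in> {h \<in> S. x h \<in> S - T} \<and> (x u, x v) \<in> (walk a' s)\<^sup>*"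
    proof cases
      case 1
      then show ?thesis
        using u xa[of u] a a'[of "x u"] by (auto simp: walk_def)
    next
      case 2
      then show ?thesis
        using u xs[of u] s a'[of "x u"] by (auto simp: walk_def)
    next
      case 3
      then show ?thesis
        using u sT[of u] s by (auto simp: walk_def x_out)
    qed
  qed (use fg x_out in auto)
  then show "(f, g) \<in> (walk a' s)\<^sup>*"
    using fg x_out by auto
qed

text \<open>A class not contained in \<open>T\<close> has a representative in \<open>S - T\<close>,
  and there \<open>r\<close> and \<open>r'\<close> have the same kernel; the classes inside
  \<open>T\<close> are what is lost when passing to \<open>S - T\<close>.\<close>

lemma card_quotient_split:
  assumes "finite S" "\<And>x. x \<in> S \<Longrightarrow> x \<in> r `` {x}"
    and "\<And>x. x \<in> S \<Longrightarrow> r `` {x} \<subseteq> S"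
    and eq: "\<And>x y. x \<in> S \<Longrightarrow> y \<in> S \<Longrightarrow> r `` {x} = r `` {y} \<longleftrightarrow> (x, y) \<in> r"
    and eq': "\<And>x y. x \<in> S - T \<Longrightarrow> y \<in> S - T \<Longrightarrow> r' `` {x} = r' `` {y} \<longleftrightarrow> (x, y) \<in> r"
  shows "card (S // r) = card ((S - T) // r') + card {c \<in> S // r. c \<subseteq> T}"
proof -
  have "r `` {x} \<in> (S - T) // r" if x: "x \<in> S" "\<not> r `` {x} \<subseteq> T" for x
  proof -
    obtain y where "(x, y) \<in> r" "y \<notin> T"
      using x by auto
    then have "r `` {x} = r `` {y}" "y \<in> S - T"
      using x assms(3)[OF x(1)] eq[of x y] by auto
    then show ?thesis
      by (simp add: quotientI)
  qed
  then have "S // r = (S - T) // r \<union> {c \<in> S // r. c \<subseteq> T}"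
    by (auto simp: quotient_eq_image)
  moreover have "(S - T) // r \<inter> {c \<in> S // r. c \<subseteq> T} = {}"
    using assms(2) by (auto simp: quotient_eq_image)
  moreover have "card ((S - T) // r) = card ((S - T) // r')"
    using card_quotient_eq[of "S - T" r r' id] eq eq' by auto
  ultimately show ?thesis
    using \<open>finite S\<close>
    by (metis (no_types, lifting) card_Un_disjoint finite_Diff finite_Un finite_imageI quotient_eq_image)
qed

section \<open>Boundary components of minors\<close>

definition turn :: "'e set \<Rightarrow> 'e corner \<Rightarrow> 'e corner" where
  "turn A f = (if fst f \<in> A then side f else seg f)"

lemma boundary_rel_eq_walk: "boundary_rel G A = (walk (arc G) (turn A))\<^sup>*"
  by (simp add: boundary_rel_def walk_def turn_def)

lemma fst_seg [simp]: "fst (seg f) = fst f" and fst_side [simp]: "fst (side f) = fst f"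
  by (cases f; simp)+

lemma turn_involution: "fst (turn A f) = fst f" "turn A f \<noteq> f" "turn A (turn A f) = f"
  by (cases f; auto simp: turn_def)+

lemma mem_corners: "f \<in> corners G \<longleftrightarrow> fst f \<in> edges G"
  by (cases f) (simp add: corners_def)

lemma ribbon_graph_arc:
  assumes "ribbon_graph G" "f \<in> corners G"
  shows "arc G f \<in> corners G" "arc G f \<noteq> f" "arc G (arc G f) = f"
    "vtx G f \<in> verts G" "vtx G (arc G f) = vtx G f" "vtx G (seg f) = vtx G f"
  using assms by (auto simp: ribbon_graph_def)

lemma finite_corners: "ribbon_graph G \<Longrightarrow> finite (corners G)"
  by (simp add: ribbon_graph_def corners_def)

lemma walk_step:
  assumes "ribbon_graph G" "f \<in> corners G" "(f, g) \<in> walk (arc G) (turn A)"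
  shows "g \<in> corners G \<and> (g, f) \<in> walk (arc G) (turn A)"
proof -
  have "g = arc G f \<or> g = turn A f"
    using assms(3) by (simp add: walk_def)
  then show ?thesis
  proof
    assume "g = arc G f"
    then show ?thesis
      using ribbon_graph_arc(1,3)[OF assms(1,2)] by (simp add: walk_def)
  next
    assume "g = turn A f"
    then show ?thesis
      using assms(2) by (simp add: walk_def mem_corners turn_involution)
  qed
qed

lemma boundary_Image_eq_iff:
  assumes "ribbon_graph G" "f \<in> corners G" "g \<in> corners G"
  shows "boundary_rel G A `` {f} = boundary_rel G A `` {g} \<longleftrightarrow> (f, g) \<in> boundary_rel G A"
  unfolding boundary_rel_eq_walk
  by (rule rtrancl_Image_eq_iff[of "corners G", OF walk_step[OF assms(1)]]) (use assms in simp_all)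

lemma boundary_rel_refl [simp]: "(f, f) \<in> boundary_rel G A"
  by (simp add: boundary_rel_def)

lemma boundary_rel_corners:
  assumes "ribbon_graph G" "f \<in> corners G" "(f, g) \<in> boundary_rel G A"
  shows "g \<in> corners G"
proof -
  have "g \<in> corners G \<and> (id f, id g) \<in> UNIV\<^sup>*"
    using assms(3) unfolding boundary_rel_eq_walk
  proof (rule rtrancl_map)
    fix u v
    assume "u \<in> corners G" "(u, v) \<in> walk (arc G) (turn A)"
    from walk_step[OF assms(1) this] show "v \<in> corners G \<and> (id u, id v) \<in> UNIV\<^sup>*"
      by (simp add: r_into_rtrancl)
  qed fact
  then show ?thesis ..
qed

text \<open>One direction is the condition in \<open>ribbon_graph\<close> that the boundary of a
  vertex disc is a single circle; for the other, neither \<open>arc\<close> nor \<open>seg\<close>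
  leaves the vertex.\<close>

lemma vtx_eq_iff:
  assumes G: "ribbon_graph G" and fg: "f \<in> corners G" "g \<in> corners G"
  shows "vtx G f = vtx G g \<longleftrightarrow> (f, g) \<in> boundary_rel G {}"
proof
  assume "(f, g) \<in> boundary_rel G {}"
  then have "g \<in> corners G \<and> (vtx G f, vtx G g) \<in> {}\<^sup>*"
    unfolding boundary_rel_eq_walk
  proof (rule rtrancl_map)
    fix u v
    assume u: "u \<in> corners G" "(u, v) \<in> walk (arc G) (turn {})"
    then show "v \<in> corners G \<and> (vtx G u, vtx G v) \<in> {}\<^sup>*"
      using walk_step[OF G u] ribbon_graph_arc[OF G u(1)]
      by (auto simp: walk_def turn_def)
  qed fact
  then show "vtx G f = vtx G g"
    by simp
qed (use assms in \<open>auto simp: ribbon_graph_def\<close>)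

text \<open>Without edges the surface is a disjoint union of discs, one circle for each. This lets
  |V| be replaced by b of the empty set, which is easier to follow through minors.\<close>

lemma num_boundary_empty:
  assumes G: "ribbon_graph G"
  shows "num_boundary G {} = card (verts G)"
proof -
  have "card (corners G // boundary_rel G {}) = card (vtx G ` corners G)"
    unfolding quotient_eq_image
    by (rule card_image_eq_if_same_kernel)
       (use boundary_Image_eq_iff[OF G] vtx_eq_iff[OF G] in auto)
  moreover have "vtx G ` corners G \<subseteq> verts G" "finite (verts G)"
    using G ribbon_graph_arc[OF G] by (auto simp: ribbon_graph_def)
  ultimately show ?thesis
    by (simp add: num_boundary_def isolated_def card_Diff_subset finite_subset card_mono)
qed

lemma quotient_subset_mono:
  assumes "\<And>x. r `` {x} \<subseteq> T \<Longrightarrow> r' `` {x} = r `` {x}"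
  shows "{c \<in> S // r. c \<subseteq> T} \<subseteq> {c \<in> S // r'. c \<subseteq> T}"
proof clarify
  fix c
  assume c: "c \<in> S // r" "c \<subseteq> T"
  obtain x where x: "c = r `` {x}" "x \<in> S"
    using c(1) by (rule quotientE)
  then have "c = r' `` {x}"
    using assms c(2) by blast
  then show "c \<in> S // r'"
    using x(2) by (metis quotientI)
qed

text \<open>
  The boundary components that disappear run along corners of \<open>e\<close> only.  There \<open>A\<close> matters only
  through \<open>e \<in> A\<close>, so they can be counted with \<open>B = {}\<close> (deletion) or \<open>B = {e}\<close> (contraction) instead.
\<close>

lemma card_boundary_reroute:
  assumes G: "ribbon_graph G" and H: "ribbon_graph H" and e: "e \<in> edges G"
    and H_eq: "edges H = edges G - {e}" "arc H = reroute G t e"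
    and t: "\<And>f. fst f = e \<Longrightarrow> t f = turn B f" and A: "e \<in> A \<longleftrightarrow> e \<in> B"
  shows "card (corners G // boundary_rel G A) =
    card (corners H // boundary_rel H A) +
    card {c \<in> corners G // boundary_rel G B. c \<subseteq> {e} \<times> UNIV}"
proof -
  let ?T = "{e} \<times> (UNIV :: (bool \<times> bool) set)"
  have cH: "corners H = corners G - ?T"
    by (auto simp: corners_def H_eq)
  have turn_eq: "turn A f = turn B f" if "f \<in> ?T" for f
    using that A by (auto simp: turn_def)
  have iff: "(f, g) \<in> boundary_rel H A \<longleftrightarrow> (f, g) \<in> boundary_rel G A"
    if "f \<in> corners G - ?T" "g \<in> corners G - ?T" for f g
    unfolding boundary_rel_eq_walk
  proof (rule walk_bypass[where S = "corners G" and T = ?T and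
      step = "\<lambda>g. if fst g = e then arc G (t g) else g" and
      p = "(e, False, False)" and q = "(e, True, True)"])
    \<comment> \<open>Diagonally opposite corners are interchanged neither by \<open>seg\<close> nor
      by \<open>side\<close>, so they represent the two pairs whether or not \<open>e\<close>
      belongs to \<open>A\<close>.\<close>
    show "?T = {(e, False, False), turn A (e, False, False), (e, True, True), turn A (e, True, True)}"
      by (auto simp: turn_def)
    show "arc H f = (if fst (if fst (arc G f) = e then arc G (t (arc G f)) else arc G f) = e
        then arc G (t (if fst (arc G f) = e then arc G (t (arc G f)) else arc G f))
        else (if fst (arc G f) = e then arc G (t (arc G f)) else arc G f))" for f
      by (simp add: H_eq reroute_def Let_def)
    show "(if fst g = e then arc G (t g) else g) =
        (if g \<in> ?T then arc G (turn A g) else g)" for g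
      using t[of g] turn_eq[of g] by (cases g) auto
    show "arc G f \<in> corners G \<and> arc G f \<noteq> f \<and> arc G (arc G f) = f" if "f \<in> corners G" for f
      using ribbon_graph_arc[OF G that] by simp
    show "turn A f \<in> corners G \<and> turn A f \<noteq> f \<and> turn A (turn A f) = f" if "f \<in> corners G" for f
      using that by (simp add: mem_corners turn_involution)
    show "arc H f \<in> corners G - ?T \<and> arc H (arc H f) = f" if "f \<in> corners G - ?T" for f
      using ribbon_graph_arc[OF H, of f] that unfolding cH by simp
    show "?T \<subseteq> corners G"
      using e by (auto simp: corners_def)
  qed (use that in simp_all)
  have "card (corners G // boundary_rel G A) =
      card ((corners G - ?T) // boundary_rel H A) + card {c \<in> corners G // boundary_rel G A. c \<subseteq> ?T}"
  proof (rule card_quotient_split)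
    show "boundary_rel H A `` {x} = boundary_rel H A `` {y} \<longleftrightarrow> (x, y) \<in> boundary_rel G A"
      if "x \<in> corners G - ?T" "y \<in> corners G - ?T" for x y
      using boundary_Image_eq_iff[OF H, of x y A] iff[OF that] that cH by simp
    show "boundary_rel G A `` {x} \<subseteq> corners G" if "x \<in> corners G" for x
      using boundary_rel_corners[OF G that] by blast
  qed (use finite_corners[OF G] boundary_Image_eq_iff[OF G] in simp_all)
  moreover have sub: "boundary_rel G A `` {x} \<subseteq> ?T \<Longrightarrow> boundary_rel G B `` {x} = boundary_rel G A `` {x}"
    "boundary_rel G B `` {x} \<subseteq> ?T \<Longrightarrow> boundary_rel G A `` {x} = boundary_rel G B `` {x}" for x
    unfolding boundary_rel_eq_walk
    by (rule walk_rtrancl_Image_eq, assumption, use turn_eq in simp)+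
  then have "{c \<in> corners G // boundary_rel G A. c \<subseteq> ?T} = {c \<in> corners G // boundary_rel G B. c \<subseteq> ?T}"
    by (intro subset_antisym quotient_subset_mono sub)
  ultimately show ?thesis
    by (simp add: cH)
qed

lemma delete_sel [simp]:
  "verts (delete e G) = verts G" "edges (delete e G) = edges G - {e}"
  "vtx (delete e G) = vtx G" "arc (delete e G) = reroute G seg e" "classes (delete e G) = classes G"
  by (simp_all add: delete_def)

text \<open>A boundary circle that runs only along the corners of the omitted edge is the boundary
  of a vertex disc meeting no other edge. Deletion removes this orbit and makes the vertex isolated,
  so the total is unchanged.\<close>

lemma num_boundary_delete:
  assumes G: "ribbon_graph G" and H: "ribbon_graph (delete e G)" and e: "e \<in> edges G" "e \<notin> A"
  shows "num_boundary (delete e G) A = num_boundary G A"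
proof -
  let ?T = "{e} \<times> (UNIV :: (bool \<times> bool) set)" and ?R = "boundary_rel G {}"
  \<comment> \<open>The corners whose vertex meets no edge except \<open>e\<close>; their vertices
    are exactly the newly isolated ones.\<close>
  define S where "S = {x \<in> corners G. ?R `` {x} \<subseteq> ?T}"
  have cH: "corners (delete e G) = corners G - ?T"
    by (auto simp: corners_def)
  have orbit: "?R `` {x} = {f \<in> corners G. vtx G f = vtx G x}" if "x \<in> corners G" for x
  proof (rule set_eqI)
    fix f
    have "(x, f) \<in> ?R \<longleftrightarrow> f \<in> corners G \<and> vtx G f = vtx G x"
      using vtx_eq_iff[OF G that, of f] boundary_rel_corners[OF G that, of f "{}"] by metis
    then show "f \<in> ?R `` {x} \<longleftrightarrow> f \<in> {f \<in> corners G. vtx G f = vtx G x}"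
      by simp
  qed
  have "{c \<in> corners G // ?R. c \<subseteq> ?T} = (\<lambda>x. ?R `` {x}) ` S"
    by (auto simp: quotient_eq_image S_def)
  moreover have "card ((\<lambda>x. ?R `` {x}) ` S) = card (vtx G ` S)"
    by (rule card_image_eq_if_same_kernel)
       (use boundary_Image_eq_iff[OF G] vtx_eq_iff[OF G] in \<open>auto simp: S_def\<close>)
  moreover have "isolated (delete e G) = isolated G \<union> vtx G ` S"
  proof -
    have a: "x \<in> S" if "x \<in> corners G" "vtx G x \<notin> vtx G ` (corners G - ?T)" for x
    proof -
      have "f \<in> ?T" if "f \<in> corners G" "vtx G f = vtx G x" for f
        using that \<open>vtx G x \<notin> _\<close> by (metis DiffI imageI)
      then show ?thesis
        using that orbit[OF that(1)] by (auto simp: S_def)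
    qed
    have b: "vtx G x \<in> verts G - vtx G ` (corners G - ?T)" if "x \<in> S" for x
    proof -
      have x: "x \<in> corners G" "{f \<in> corners G. vtx G f = vtx G x} \<subseteq> ?T"
        using that orbit[of x] by (simp_all add: S_def)
      have "vtx G x \<notin> vtx G ` (corners G - ?T)"
      proof
        assume "vtx G x \<in> vtx G ` (corners G - ?T)"
        then obtain f where "vtx G x = vtx G f" "f \<in> corners G - ?T"
          by (rule imageE)
        then show False
          using subsetD[OF x(2), of f] by simp
      qed
      then show ?thesis
        using x ribbon_graph_arc(4)[OF G, of x] by blast
    qed
    have "y \<in> (verts G - vtx G ` corners G) \<union> vtx G ` S"
      if y: "y \<in> verts G - vtx G ` (corners G - ?T)" for y
    proof (cases "y \<in> vtx G ` corners G")
      case True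
      then obtain x where "y = vtx G x" "x \<in> corners G"
        by (rule imageE)
      with a[of x] y show ?thesis
        by simp
    qed (use y in simp)
    moreover have "vtx G ` (corners G - ?T) \<subseteq> vtx G ` corners G"
      by (rule image_mono) simp
    moreover have "vtx G ` S \<subseteq> verts G - vtx G ` (corners G - ?T)"
      using b by (rule image_subsetI)
    ultimately show ?thesis
      unfolding isolated_def cH delete_sel
      by (intro subset_antisym Un_least Diff_mono order_refl) (rule subsetI)
  qed
  moreover have "isolated G \<inter> vtx G ` S = {}"
    by (auto simp: isolated_def S_def)
  moreover have "finite (isolated G)" "finite S"
    using G finite_corners[OF G] by (auto simp: isolated_def S_def ribbon_graph_def)
  moreover have "card (corners G // boundary_rel G A) =
    card (corners (delete e G) // boundary_rel (delete e G) A) + card {c \<in> corners G // ?R. c \<subseteq> ?T}"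
    by (rule card_boundary_reroute[OF G H e(1)]) (use e in \<open>auto simp: turn_def\<close>)
  ultimately show ?thesis
    by (simp add: num_boundary_def card_Un_disjoint)
qed

text \<open>The choice in the definition is possible because there are finitely many circles and
  infinitely many names outside \<open>verts G\<close>.\<close>

lemma new_vertex:
  fixes G :: "('v :: infinite, 'e) vcrg"
  assumes G: "ribbon_graph G"
  shows "inj_on (new_vertex G e) (contraction_circles G e)"
    "new_vertex G e ` contraction_circles G e \<inter> (verts G - ends G e) = {}"
proof -
  let ?P = "\<lambda>\<nu>. inj_on \<nu> (contraction_circles G e) \<and>
        \<nu> ` contraction_circles G e \<inter> (verts G - ends G e) = {}"
  have fin: "finite (contraction_circles G e)"
    using finite_corners[OF G] by (simp add: contraction_circles_def quotient_eq_image)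
  have "infinite (UNIV - verts G)"
    using G infinite_UNIV by (simp add: ribbon_graph_def)
  then obtain B where B: "finite B" "card B = card (contraction_circles G e)" "B \<subseteq> UNIV - verts G"
    by (meson infinite_arbitrarily_large)
  with fin obtain \<nu> where "bij_betw \<nu> (contraction_circles G e) B"
    by (metis finite_same_card_bij)
  then have "?P \<nu>"
    using B by (auto simp: bij_betw_def)
  then have "?P (new_vertex G e)"
    unfolding new_vertex_def by (rule someI[of ?P])
  then show "inj_on (new_vertex G e) (contraction_circles G e)"
    "new_vertex G e ` contraction_circles G e \<inter> (verts G - ends G e) = {}"
    by auto
qed

lemma contract_sel [simp]:
  "verts (contract e G) = (verts G - ends G e) \<union> new_vertex G e ` contraction_circles G e"
  "edges (contract e G) = edges G - {e}"
  "vtx (contract e G) = (\<lambda>f. if vtx G f \<in> ends G e then new_vertex G e (boundary_rel G {e} `` {f})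
                  else vtx G f)"
  "arc (contract e G) = reroute G side e"
  "classes (contract e G) = {C \<in> classes G. C \<inter> ends G e = {}} \<union>
     {(\<Union>{C \<in> classes G. C \<inter> ends G e \<noteq> {}} - ends G e) \<union>
       new_vertex G e ` contraction_circles G e}"
  by (simp_all add: contract_def Let_def)

text \<open>A boundary circle that runs only along the corners of the contracted edge is filled by a
  new vertex without edges. This lost orbit is therefore balanced by an isolated vertex; the other
  new vertices retain a corner and are not isolated.\<close>

lemma num_boundary_contract:
  fixes G :: "('v :: infinite, 'e) vcrg"
  assumes G: "ribbon_graph G" and H: "ribbon_graph (contract e G)" and e: "e \<in> edges G" "e \<notin> A"
  shows "num_boundary (contract e G) A = num_boundary G (insert e A)"
proof -
  let ?T = "{e} \<times> (UNIV :: (bool \<times> bool) set)" and ?R = "boundary_rel G {e}"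
  let ?K = "contraction_circles G e" and ?\<nu> = "new_vertex G e"
  let ?H = "contract e G"
  have cH: "corners ?H = corners G - ?T"
    by (auto simp: corners_def)
  have vT: "vtx G f \<in> ends G e" if "f \<in> ?T" for f
    using that by (auto simp: ends_def)
  have TC: "?T \<subseteq> corners G"
    using e by (auto simp: corners_def)
  have K: "?R `` {f} \<in> ?K" if "f \<in> corners G" "vtx G f \<in> ends G e" for f
    using that by (auto simp: contraction_circles_def quotientI)
  \<comment> \<open>A component confined to the corners of \<open>e\<close> automatically starts at
    an end of \<open>e\<close>, hence is one of the circles to which a disc is glued.\<close>
  have circles: "{c \<in> corners G // ?R. c \<subseteq> ?T} = {c \<in> ?K. c \<subseteq> ?T}"
  proof -
    have "vtx G f \<in> ends G e" if "?R `` {f} \<subseteq> ?T" for f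
    proof -
      have "f \<in> ?R `` {f}"
        by simp
      then show ?thesis
        using that vT[of f] by blast
    qed
    then show ?thesis
      by (auto simp: contraction_circles_def quotient_eq_image)
  qed
  have iso: "isolated ?H = isolated G \<union> ?\<nu> ` {c \<in> ?K. c \<subseteq> ?T}"
  proof -
    have ends: "ends G e \<subseteq> vtx G ` corners G"
      using TC by (auto simp: ends_def)
    have new: "?\<nu> c \<notin> verts G - ends G e" if "c \<in> ?K" for c
      using that new_vertex(2)[OF G] by blast
    have a: "?\<nu> c \<in> vtx ?H ` (corners G - ?T) \<longleftrightarrow> \<not> c \<subseteq> ?T" if c: "c \<in> ?K" for c
    proof
      assume "?\<nu> c \<in> vtx ?H ` (corners G - ?T)"
      then obtain f where f: "?\<nu> c = vtx ?H f" "f \<in> corners G - ?T"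
        by (rule imageE)
      then have v: "vtx G f \<in> ends G e"
        using new[OF c] ribbon_graph_arc(4)[OF G, of f] by (auto split: if_splits)
      then have "?\<nu> c = ?\<nu> (?R `` {f})"
        using f by simp
      then have "c = ?R `` {f}"
        by (rule inj_onD[OF new_vertex(1)[OF G]]) (use c K f v in simp_all)
      then have "f \<in> c"
        by simp
      then show "\<not> c \<subseteq> ?T"
        using f(2) by blast
    next
      assume "\<not> c \<subseteq> ?T"
      then obtain f where f: "f \<in> c" "f \<notin> ?T"
        by blast
      obtain g where g: "g \<in> corners G" "vtx G g \<in> ends G e" "c = ?R `` {g}"
        using c unfolding contraction_circles_def by (elim quotientE) blast
      have fC: "f \<in> corners G"
        using f g boundary_rel_corners[OF G g(1), of f "{e}"] by simp
      have "?R `` {f} = c"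
        using f g boundary_Image_eq_iff[OF G g(1) fC, of "{e}"] by simp
      \<comment> \<open>Along the boundary only the free sides of \<open>e\<close> can change the
        vertex, and they lead from one end of \<open>e\<close> to the other.\<close>
      moreover have "vtx G f \<in> ends G e"
      proof -
        have "f \<in> {f \<in> corners G. vtx G f \<in> ends G e} \<and> (id g, id f) \<in> UNIV\<^sup>*"
          using f(1) unfolding g(3) boundary_rel_eq_walk Image_singleton_iff
        proof (rule rtrancl_map)
          fix u v
          assume u: "u \<in> {f \<in> corners G. vtx G f \<in> ends G e}" "(u, v) \<in> walk (arc G) (turn {e})"
          then show "v \<in> {f \<in> corners G. vtx G f \<in> ends G e} \<and> (id u, id v) \<in> UNIV\<^sup>*"
          proof -
            have uC: "u \<in> corners G"
              using u by simp
            consider "v = arc G u" | "v = seg u" | "v = side u" "fst u = e"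
              using u(2) by (auto simp: walk_def turn_def split: if_splits)
            then have "vtx G v \<in> ends G e"
            proof cases
              case 3
              then have "v \<in> ?T"
                by (cases u) simp
              then show ?thesis
                by (rule vT)
            qed (use u ribbon_graph_arc[OF G uC] in simp_all)
            then show ?thesis
              using walk_step[OF G uC u(2)] by (simp add: r_into_rtrancl)
          qed
        qed (use g in simp)
        then show ?thesis by simp
      qed
      ultimately show "?\<nu> c \<in> vtx ?H ` (corners G - ?T)"
        using f(2) fC by (intro image_eqI[of _ _ f]) simp_all
    qed
    have b: "x \<in> vtx ?H ` (corners G - ?T) \<longleftrightarrow> x \<in> vtx G ` corners G" if x: "x \<in> verts G - ends G e" for x
    proof
      assume "x \<in> vtx ?H ` (corners G - ?T)"
      then obtain f where f: "x = vtx ?H f" "f \<in> corners G - ?T"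
        by (rule imageE)
      have "vtx G f \<notin> ends G e"
      proof
        assume "vtx G f \<in> ends G e"
        then have "x = ?\<nu> (?R `` {f})" "?R `` {f} \<in> ?K"
          using f K by simp_all
        then show False
          using new x by blast
      qed
      then show "x \<in> vtx G ` corners G"
        using f by simp
    next
      assume "x \<in> vtx G ` corners G"
      then obtain f where "x = vtx G f" "f \<in> corners G"
        by (rule imageE)
      moreover from this have "f \<notin> ?T"
        using x vT[of f] by blast
      ultimately show "x \<in> vtx ?H ` (corners G - ?T)"
        using x by (intro image_eqI[of _ _ f]) simp_all
    qed
    show ?thesis
    proof (rule set_eqI)
      fix x
      consider (old) "x \<in> verts G - ends G e" | (new) "x \<notin> verts G - ends G e" "x \<in> ?\<nu> ` ?K"
        | (no) "x \<notin> verts G - ends G e" "x \<notin> ?\<nu> ` ?K"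
        by blast
      then show "x \<in> isolated ?H \<longleftrightarrow> x \<in> isolated G \<union> ?\<nu> ` {c \<in> ?K. c \<subseteq> ?T}"
      proof cases
        case old
        then have "x \<notin> ?\<nu> ` ?K"
          using new by blast
        then have "x \<notin> ?\<nu> ` {c \<in> ?K. c \<subseteq> ?T}"
          by blast
        then show ?thesis
          using old b[OF old] by (simp add: isolated_def cH del: contract_sel(3))
      next
        case new
        then obtain c where c: "c \<in> ?K" "x = ?\<nu> c"
          by blast
        have "x \<notin> isolated G"
          using new ends unfolding isolated_def by blast
        moreover have "?\<nu> c \<in> ?\<nu> ` {c \<in> ?K. c \<subseteq> ?T} \<longleftrightarrow> c \<in> {c \<in> ?K. c \<subseteq> ?T}"
          using c(1) by (intro inj_on_image_mem_iff[OF new_vertex(1)[OF G, of e]]) simp_all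
        moreover have "x \<in> isolated ?H \<longleftrightarrow> c \<subseteq> ?T"
          using a[OF c(1)] c by (simp add: isolated_def cH del: contract_sel(3))
        ultimately show ?thesis
          using c by simp
      next
        case no
        then have "x \<notin> ?\<nu> ` {c \<in> ?K. c \<subseteq> ?T}"
          by blast
        then show ?thesis
          using no ends unfolding isolated_def contract_sel(1) by blast
      qed
    qed
  qed
  have "isolated G \<inter> ?\<nu> ` {c \<in> ?K. c \<subseteq> ?T} = {}"
  proof -
    have "isolated G \<subseteq> verts G - ends G e"
      using TC unfolding isolated_def ends_def by blast
    then show ?thesis
      using new_vertex(2)[OF G, of e] by blast
  qed
  moreover have "card (?\<nu> ` {c \<in> ?K. c \<subseteq> ?T}) = card {c \<in> ?K. c \<subseteq> ?T}"
    by (rule card_image) (rule inj_on_subset[OF new_vertex(1)[OF G]], auto)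
  moreover have "finite (isolated G)" "finite ?K"
    using G finite_corners[OF G]
    by (auto simp: isolated_def ribbon_graph_def contraction_circles_def quotient_eq_image)
  moreover have "card (corners G // boundary_rel G (insert e A)) =
    card (corners ?H // boundary_rel ?H (insert e A)) + card {c \<in> corners G // ?R. c \<subseteq> ?T}"
    by (rule card_boundary_reroute[OF G H e(1)]) (auto simp: turn_def)
  \<comment> \<open>In the minor no corner belongs to \<open>e\<close>, so membership of
    \<open>e\<close> is invisible to a walk. The relations may differ outside the corners, hence the
    restriction to walks that start at a corner.\<close>
  moreover have "corners ?H // boundary_rel ?H (insert e A) = corners ?H // boundary_rel ?H A"
  proof -
    have mono: "(x, y) \<in> boundary_rel ?H B" if "(x, y) \<in> boundary_rel ?H B'" "x \<in> corners ?H"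
      "insert e B = insert e B'" for x y B B'
    proof -
      have "y \<in> corners ?H \<and> (id x, id y) \<in> (walk (arc ?H) (turn B))\<^sup>*"
        using that(1) unfolding boundary_rel_eq_walk
      proof (rule rtrancl_map)
        fix u v
        assume u: "u \<in> corners ?H" "(u, v) \<in> walk (arc ?H) (turn B')"
        have "turn B u = turn B' u"
          using u(1) that(3) by (auto simp: turn_def mem_corners)
        then have "(u, v) \<in> walk (arc ?H) (turn B)"
          using u(2) by (simp add: walk_def)
        then show "v \<in> corners ?H \<and> (id u, id v) \<in> (walk (arc ?H) (turn B))\<^sup>*"
          using walk_step[OF H u] by (simp add: r_into_rtrancl)
      qed fact
      then show ?thesis
        by (simp add: boundary_rel_eq_walk)
    qed
    have "boundary_rel ?H (insert e A) `` {x} = boundary_rel ?H A `` {x}" if "x \<in> corners ?H" for x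
    proof -
      have "(x, y) \<in> boundary_rel ?H (insert e A) \<longleftrightarrow> (x, y) \<in> boundary_rel ?H A" for y
        using mono[of x y A "insert e A"] mono[of x y "insert e A" A] that by (simp add: iffI)
      then show ?thesis
        by (simp add: Image_def)
    qed
    then show ?thesis
      unfolding quotient_eq_image by (rule image_cong[OF refl])
  qed
  ultimately show ?thesis
    using iso circles by (simp add: num_boundary_def card_Un_disjoint)
qed

section \<open>Components of the class graph\<close>

lemma ends_eq:
  assumes "ribbon_graph G" "e \<in> edges G"
  shows "ends G e = {vtx G (e, False, False), vtx G (e, True, False)}"
proof -
  have "vtx G (e, i, True) = vtx G (e, i, False)" for i
    using ribbon_graph_arc(6)[OF assms(1), of "(e, i, False)"] assms(2) by (simp add: mem_corners)
  moreover have "{e} \<times> UNIV = {(e, False, False), (e, False, True), (e, True, False), (e, True, True)}"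
    by auto
  ultimately show ?thesis
    by (simp add: ends_def insert_commute)
qed

lemma ends_subset_verts: "ribbon_graph G \<Longrightarrow> e \<in> edges G \<Longrightarrow> ends G e \<subseteq> verts G"
  using ribbon_graph_arc(4) by (auto simp: ends_def mem_corners)

lemma class_of_eq:
  assumes "vc_ribbon_graph G" "C \<in> classes G" "x \<in> C"
  shows "class_of G x = C"
proof -
  have "disjoint (classes G)"
    using assms(1) by (simp add: vc_ribbon_graph_def partition_on_def)
  then have eq: "D = C" if "D \<in> classes G" "x \<in> D" for D
    using disjointD[of "classes G" C D] assms(2) IntI[OF assms(3) that(2)] that(1)
    by (cases "D = C") simp_all
  show ?thesis
    unfolding class_of_def
  proof (rule the_equality)
    show "C \<in> classes G \<and> x \<in> C"
      using assms by simp
    show "D = C" if "D \<in> classes G \<and> x \<in> D" for D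
      using that by (elim conjE) (rule eq)
  qed
qed

lemma class_of_mem:
  assumes "vc_ribbon_graph G" "x \<in> verts G"
  shows "class_of G x \<in> classes G" "x \<in> class_of G x"
proof -
  obtain C where "C \<in> classes G" "x \<in> C"
    using assms by (auto simp: vc_ribbon_graph_def partition_on_def)
  with class_of_eq[OF assms(1)] show "class_of G x \<in> classes G" "x \<in> class_of G x"
    by simp_all
qed

definition class_links :: "('v, 'e) vcrg \<Rightarrow> 'e set \<Rightarrow> ('v set \<times> 'v set) set" where
  "class_links G A = {(x, y). \<exists>e \<in> A. class_of G ` ends G e = {x, y}}"

lemma num_components_class_graph:
  "num_components (class_graph G) A = card (classes G // (class_links G A)\<^sup>*)"
  by (simp add: num_components_def class_graph_def class_links_def)

lemma class_links_Image_eq_iff: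
  "(class_links G A)\<^sup>* `` {x} = (class_links G A)\<^sup>* `` {y} \<longleftrightarrow> (x, y) \<in> (class_links G A)\<^sup>*"
  by (rule rtrancl_Image_eq_iff[of UNIV]) (auto simp: class_links_def insert_commute)

lemma num_components_empty: "num_components (class_graph G) {} = card (classes G)"
proof -
  have "class_links G {} = {}"
    by (simp add: class_links_def)
  then show ?thesis
    by (simp add: num_components_class_graph quotient_eq_image card_image inj_on_def)
qed

text \<open>The map \<open>h\<close> may merge classes, provided that merged classes lie in one
  component. It is the merging map for contraction and the induced bijection of classes for
  equivalence.\<close>

lemma num_components_eq:
  assumes "h ` classes G = classes H"
    and "\<And>x y. x \<in> classes G \<Longrightarrow> y \<in> classes G \<Longrightarrow>
      (x, y) \<in> (class_links G A)\<^sup>* \<longleftrightarrow> (h x, h y) \<in> (class_links H B)\<^sup>*"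
  shows "num_components (class_graph G) A = num_components (class_graph H) B"
  unfolding num_components_class_graph assms(1)[symmetric]
  by (rule card_quotient_eq) (simp add: class_links_Image_eq_iff assms(2))

lemma num_components_delete:
  "num_components (class_graph (delete e G)) A = num_components (class_graph G) A"
  by (simp add: num_components_class_graph class_links_def class_of_def ends_def)

text \<open>The class graph of the minor arises by identifying the end classes of \<open>e\<close>:
  \<open>h\<close> sends each class meeting the ends to the merged class \<open>N\<close>, fixes the
  others, and commutes with passing from corners to classes. Two different classes with the same
  image are joined by the link \<open>e\<close>.\<close>

lemma num_components_contract:
  fixes G :: "('v :: infinite, 'e) vcrg"
  assumes G: "vc_ribbon_graph G" and H: "vc_ribbon_graph (contract e G)"
    and e: "e \<in> edges G" and A: "A \<subseteq> edges G"
  shows "num_components (class_graph (contract e G)) A = num_components (class_graph G) (insert e A)"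
proof -
  let ?H = "contract e G"
  let ?new = "new_vertex G e ` contraction_circles G e"
  define N where "N = (\<Union>{C \<in> classes G. C \<inter> ends G e \<noteq> {}} - ends G e) \<union> ?new"
  define h where "h C = (if C \<inter> ends G e = {} then C else N)" for C
  have rG: "ribbon_graph G"
    using G by (simp add: vc_ribbon_graph_def)
  have cls: "classes ?H = {C \<in> classes G. C \<inter> ends G e = {}} \<union> {N}"
    by (simp add: N_def)
  have vC: "vtx G f \<in> verts G" if "fst f \<in> edges G" for f
    using ribbon_graph_arc(4)[OF rG] that by (simp add: mem_corners)
  have new: "new_vertex G e (boundary_rel G {e} `` {f}) \<in> ?new"
    if "fst f \<in> edges G" "vtx G f \<in> ends G e" for f
    using that by (auto simp: contraction_circles_def quotient_eq_image mem_corners)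
  define f0 where "f0 = (e, False, False)"
  have f0: "fst f0 \<in> edges G" "vtx G f0 \<in> ends G e"
    using e by (auto simp: f0_def ends_def)
  have c0: "class_of G (vtx G f0) \<in> classes G" "class_of G (vtx G f0) \<inter> ends G e \<noteq> {}"
    using class_of_mem[OF G vC[OF f0(1)]] f0(2) by auto
  have img: "h ` classes G = classes ?H"
    unfolding cls using c0 by (auto simp: h_def image_iff)
  \<comment> \<open>\<open>N\<close> contains a new vertex, whose name is taken by no surviving
    vertex. Thus \<open>h\<close> identifies only classes that meet the ends of
    \<open>e\<close>.\<close>
  have N: "N \<noteq> C" if "C \<in> classes G" "C \<inter> ends G e = {}" for C
  proof -
    have "C \<subseteq> verts G - ends G e"
      using that G by (auto simp: vc_ribbon_graph_def partition_on_def)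
    then show ?thesis
      using new[OF f0] new_vertex(2)[OF rG, of e] unfolding N_def by blast
  qed
  have M: "class_of G ` ends G e = {C \<in> classes G. C \<inter> ends G e \<noteq> {}}"
  proof -
    have "x \<in> verts G" if "x \<in> ends G e" for x
      using that ends_subset_verts[OF rG e] by blast
    then have "class_of G ` ends G e \<subseteq> {C \<in> classes G. C \<inter> ends G e \<noteq> {}}"
      using class_of_mem[OF G] by blast
    moreover have "C \<in> class_of G ` ends G e" if "C \<in> classes G" "x \<in> C" "x \<in> ends G e" for C x
      using class_of_eq[OF G that(1,2)] that(3) by blast
    ultimately show ?thesis
      by blast
  qed
  have cv: "class_of ?H (vtx ?H f) = h (class_of G (vtx G f))" if f: "fst f \<in> edges G" for f
  proof -
    note c = class_of_mem[OF G vC[OF f]]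
    have "h (class_of G (vtx G f)) \<in> classes ?H"
      using img c(1) by blast
    moreover have "vtx ?H f \<in> h (class_of G (vtx G f))"
    proof (cases "vtx G f \<in> ends G e")
      case True
      then have "h (class_of G (vtx G f)) = N"
        using c(2) by (auto simp: h_def)
      then show ?thesis
        using new[OF f True] True by (simp add: N_def)
    next
      case False
      then show ?thesis
        using c by (auto simp: h_def N_def)
    qed
    ultimately show ?thesis
      by (rule class_of_eq[OF H])
  qed
  have link: "class_of ?H ` ends ?H f = h ` class_of G ` ends G f" if "f \<in> edges G" for f
    unfolding ends_def image_image by (rule image_cong[OF refl], rule cv) (use that in auto)
  have same: "(x, y) \<in> (class_links G (insert e A))\<^sup>*"
    if "x \<in> classes G" "y \<in> classes G" "h x = h y" for x y
  proof (cases "x = y")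
    case False
    then have "x \<in> class_of G ` ends G e" "y \<in> class_of G ` ends G e"
      unfolding M using that N by (auto simp: h_def split: if_splits)
    then have "class_of G ` ends G e = {x, y}"
      using False unfolding ends_eq[OF rG e] by auto
    then show ?thesis
      by (auto simp: class_links_def)
  qed simp
  have "(x, y) \<in> (class_links G (insert e A))\<^sup>* \<longleftrightarrow> (h x, h y) \<in> (class_links ?H A)\<^sup>*"
    if xy: "x \<in> classes G" "y \<in> classes G" for x y
  proof
    assume "(x, y) \<in> (class_links G (insert e A))\<^sup>*"
    then have "y \<in> UNIV \<and> (h x, h y) \<in> (class_links ?H A)\<^sup>*"
    proof (rule rtrancl_map)
      fix u v
      assume "(u, v) \<in> class_links G (insert e A)"
      then obtain f where f: "f \<in> insert e A" "class_of G ` ends G f = {u, v}"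
        by (auto simp: class_links_def)
      show "v \<in> UNIV \<and> (h u, h v) \<in> (class_links ?H A)\<^sup>*"
      proof (cases "f = e")
        case True
        then have "u \<inter> ends G e \<noteq> {}" "v \<inter> ends G e \<noteq> {}"
          using f(2) M by auto
        then show ?thesis
          by (simp add: h_def)
      next
        case False
        then have "f \<in> A" "class_of ?H ` ends ?H f = {h u, h v}"
          using f A link[of f] by auto
        then show ?thesis
          by (auto simp: class_links_def)
      qed
    qed simp
    then show "(h x, h y) \<in> (class_links ?H A)\<^sup>*" ..
  next
    assume "(h x, h y) \<in> (class_links ?H A)\<^sup>*"
    \<comment> \<open>A vertex \<open>w\<close> of the walk can have two preimages under
      \<open>h\<close>, so the induction hypothesis covers all of them.\<close>
    moreover have "\<forall>y \<in> classes G. h y = w \<longrightarrow> (x, y) \<in> (class_links G (insert e A))\<^sup>*"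
      if "(h x, w) \<in> (class_links ?H A)\<^sup>*" for w
      using that
    proof (induction rule: rtrancl_induct)
      case base
      then show ?case
        using same[OF xy(1)] by simp
    next
      case (step w z)
      obtain f where f: "f \<in> A" "class_of ?H ` ends ?H f = {w, z}"
        using step(2) by (auto simp: class_links_def)
      have fE: "f \<in> edges G"
        using f A by auto
      obtain p0 q0 where pq0: "ends G f = {p0, q0}"
        using ends_eq[OF rG fE] by blast
      then have "class_of G ` ends G f = {class_of G p0, class_of G q0}"
        "class_of G p0 \<in> classes G" "class_of G q0 \<in> classes G"
        using ends_subset_verts[OF rG fE] class_of_mem(1)[OF G] by auto
      moreover have "h ` class_of G ` ends G f = {w, z}"
        using f(2) link[OF fE] by simp
      ultimately obtain p q where pq: "class_of G ` ends G f = {p, q}"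
        "p \<in> classes G" "q \<in> classes G" "h p = w" "h q = z"
        by (auto simp: doubleton_eq_iff)
      have "(p, q) \<in> class_links G (insert e A)"
        using f(1) pq(1) by (auto simp: class_links_def)
      moreover have "(x, p) \<in> (class_links G (insert e A))\<^sup>*"
        using step.IH pq by blast
      ultimately have "(x, q) \<in> (class_links G (insert e A))\<^sup>*"
        by simp
      then show ?case
        using same pq by (metis rtrancl_trans)
    qed
    ultimately show "(x, y) \<in> (class_links G (insert e A))\<^sup>*"
      using xy by blast
  qed
  then show ?thesis
    using num_components_eq[OF img] by metis
qed

lemma doubleton_pairs: "{(x, y). {p, q} = {x, y}} = {(p, q), (q, p)}"
  by (auto simp: doubleton_eq_iff)

lemma image_replace:
  "p \<in> S \<Longrightarrow> (\<lambda>x. if x = q then p else x) ` S = (if p = q then S else S - {q})"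
  by (auto simp: image_iff)

text \<open>Folding the class of \<open>v\<close> onto the class of \<open>u\<close> describes the
  components, so one is lost precisely when the two classes differ.\<close>

lemma num_components_single:
  assumes G: "vc_ribbon_graph G" and u: "u \<in> verts G" "v \<in> verts G" "ends G e = {u, v}"
  shows "card (classes G) =
    num_components (class_graph G) {e} + (if class_of G u = class_of G v then 0 else 1)"
proof -
  define p where "p = class_of G u"
  define q where "q = class_of G v"
  have pq: "p \<in> classes G" "q \<in> classes G"
    using class_of_mem(1)[OF G] u by (simp_all add: p_def q_def)
  define h where "h C = (if C = q then p else C)" for C
  have L: "class_links G {e} = {(p, q), (q, p)}"
    by (simp add: class_links_def u(3) doubleton_pairs flip: p_def q_def)
  have "(x, y) \<in> {(p, q), (q, p)}\<^sup>* \<longleftrightarrow> h x = h y" for x y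
  proof
    assume "(x, y) \<in> {(p, q), (q, p)}\<^sup>*"
    then have "y \<in> UNIV \<and> (h x, h y) \<in> {}\<^sup>*"
      by (rule rtrancl_map) (auto simp: h_def)
    then show "h x = h y"
      by simp
  next
    assume "h x = h y"
    then have "x = y \<or> (x, y) \<in> {(p, q), (q, p)}"
      by (auto simp: h_def split: if_splits)
    then show "(x, y) \<in> {(p, q), (q, p)}\<^sup>*"
      by (elim disjE) (simp, rule r_into_rtrancl)
  qed
  then have "num_components (class_graph G) {e} = card (h ` classes G)"
    unfolding num_components_class_graph quotient_eq_image
    using class_links_Image_eq_iff[of G "{e}"] unfolding L by (intro card_image_eq_if_same_kernel) simp
  moreover have "h ` classes G = (if p = q then classes G else classes G - {q})"
    unfolding h_def by (rule image_replace[OF pq(1)])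
  moreover have "finite (classes G)"
  proof (rule finite_UnionD)
    show "finite (\<Union> (classes G))"
      using G by (simp add: vc_ribbon_graph_def ribbon_graph_def partition_on_def)
  qed
  ultimately have "card (classes G) = num_components (class_graph G) {e} + (if p = q then 0 else 1)"
    using card_Suc_Diff1[OF _ pq(2)] by simp
  then show ?thesis
    unfolding p_def q_def .
qed

section \<open>Edge types\<close>

text \<open>On the four corners of the only edge, \<open>arc\<close> is an involution without fixed
  points, and four points have just three perfect matchings. They are the disc with two vertices,
  the annulus and the Moebius band.\<close>

lemma single_edge_arc:
  assumes G: "ribbon_graph G" and e: "edges G = {e}"
  obtains "\<And>f. f \<in> corners G \<Longrightarrow> arc G f = seg f"
    | "\<And>f. f \<in> corners G \<Longrightarrow> arc G f = side f"
    | "\<And>f. f \<in> corners G \<Longrightarrow> arc G f = side (seg f)"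
proof -
  let ?p = "(e, False, False)" and ?p' = "(e, False, True)"
    and ?q = "(e, True, False)" and ?q' = "(e, True, True)"
  have C: "corners G = {?p, ?p', ?q, ?q'}"
    by (auto simp: corners_def e)
  have a: "arc G f \<in> {?p, ?p', ?q, ?q'}" "arc G f \<noteq> f" "arc G (arc G f) = f"
    if "f \<in> {?p, ?p', ?q, ?q'}" for f
    using ribbon_graph_arc(1-3)[OF G, of f] that unfolding C by simp_all
  have ap: "arc G ?p \<in> {?p', ?q, ?q'}" and ap': "arc G ?p' \<in> {?p, ?q, ?q'}"
    and aq: "arc G ?q \<in> {?p, ?p', ?q'}" and aq': "arc G ?q' \<in> {?p, ?p', ?q}"
    using a(1,2)[of ?p] a(1,2)[of ?p'] a(1,2)[of ?q] a(1,2)[of ?q'] by auto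
  note aa = a(3)[of ?p] a(3)[of ?p'] a(3)[of ?q] a(3)[of ?q']
  consider "arc G ?p = ?p'" "arc G ?p' = ?p" "arc G ?q = ?q'" "arc G ?q' = ?q"
    | "arc G ?p = ?q" "arc G ?q = ?p" "arc G ?p' = ?q'" "arc G ?q' = ?p'"
    | "arc G ?p = ?q'" "arc G ?q' = ?p" "arc G ?p' = ?q" "arc G ?q = ?p'"
    using ap ap' aq aq' aa by auto
  then show thesis
  proof cases
    case 1
    then have "\<forall>f \<in> corners G. arc G f = seg f"
      by (simp add: C)
    then show thesis
      using that(1) by blast
  next
    case 2
    then have "\<forall>f \<in> corners G. arc G f = side f"
      by (simp add: C)
    then show thesis
      using that(2) by blast
  next
    case 3
    then have "\<forall>f \<in> corners G. arc G f = side (seg f)"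
      by (simp add: C)
    then show thesis
      using that(3) by blast
  qed
qed

lemma single_edge_isolated:
  assumes "edges G = {e}"
  shows "isolated G = verts G - ends G e"
  by (simp add: isolated_def ends_def corners_def assms)

lemma single_edge_boundary:
  assumes G: "ribbon_graph G" and e: "edges G = {e}"
  shows "of_nat (num_boundary G {}) - of_nat (num_boundary G {e}) =
    (of_nat (card (ends G e)) - of_nat (card (corners G // boundary_rel G {e})) :: rat)"
proof -
  have "ends G e \<subseteq> verts G" "finite (verts G)"
    using ends_subset_verts[OF G] e G by (auto simp: ribbon_graph_def)
  then have "card (verts G) = card (ends G e) + card (isolated G)"
    unfolding single_edge_isolated[OF e] by (metis card_Diff_subset card_mono finite_subset le_add_diff_inverse)
  then show ?thesis
    unfolding num_boundary_empty[OF G] by (simp add: num_boundary_def)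
qed

lemma card_quotient_1:
  assumes "x \<in> S" "\<And>y. y \<in> S \<Longrightarrow> r `` {y} = r `` {x}"
  shows "card (S // r) = 1"
proof -
  have "S // r = (\<lambda>_. r `` {x}) ` S"
    unfolding quotient_eq_image by (rule image_cong[OF refl]) (fact assms(2))
  then show ?thesis
    using assms(1) by (simp add: image_constant[of x])
qed

text \<open>The three matchings of \<open>single_edge_arc\<close> yield the three alternatives in
  this order.\<close>

lemma single_edge_cases:
  fixes G :: "('v, 'e) vcrg"
  assumes G: "ribbon_graph G" and e: "edges G = {e}"
  obtains u v where "ends G e = {u, v}" "u \<noteq> v" "card (corners G // boundary_rel G {e}) = 1"
    | u where "ends G e = {u}" "orientable_loop G e" "card (corners G // boundary_rel G {e}) = 2"
    | u where "ends G e = {u}" "nonorientable_loop G e" "card (corners G // boundary_rel G {e}) = 1"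
proof -
  let ?p = "(e, False, False)" and ?p' = "(e, False, True)"
    and ?q = "(e, True, False)" and ?q' = "(e, True, True)"
  let ?R = "boundary_rel G {e}" and ?W = "walk (arc G) (turn {e})"
  have C: "corners G = {?p, ?p', ?q, ?q'}"
    by (auto simp: corners_def e)
  have ends: "ends G e = {vtx G ?p, vtx G ?q}"
    using ends_eq[OF G] e by simp
  \<comment> \<open>The free sides already join the corners in pairs across the edge, so a
    connection between the two sides leaves one component.\<close>
  have one: "card (corners G // ?R) = 1" if "(?p, ?p') \<in> ?R"
  proof (rule card_quotient_1[where x = ?p])
    have "(?p, ?q) \<in> ?W" "(?p', ?q') \<in> ?W"
      by (simp_all add: walk_def turn_def)
    then have "(?p, ?q) \<in> ?R" "(?p, ?q') \<in> ?R"
      using that unfolding boundary_rel_eq_walk by (auto intro: rtrancl_into_rtrancl)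
    with that have "(?p, y) \<in> ?R" if "y \<in> corners G" for y
      using that unfolding C by auto
    then show "?R `` {y} = ?R `` {?p}" if "y \<in> corners G" for y
      using boundary_Image_eq_iff[OF G, of ?p y "{e}"] that unfolding C by simp
  qed (simp add: C)
  show thesis
  proof (cases rule: single_edge_arc[OF G e])
    case 1
    \<comment> \<open>Here \<open>arc\<close> and \<open>seg\<close> coincide and preserve the bit
      naming the end segment, so no walk along a vertex boundary passes between the two
      ends.\<close>
    have "vtx G ?p \<noteq> vtx G ?q"
    proof
      assume "vtx G ?p = vtx G ?q"
      then have "(?p, ?q) \<in> (walk (arc G) (turn {}))\<^sup>*"
        using vtx_eq_iff[OF G, of ?p ?q] by (simp add: C boundary_rel_eq_walk)
      then have "?q \<in> corners G \<and> (fst (snd ?p), fst (snd ?q)) \<in> {}\<^sup>*"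
      proof (rule rtrancl_map[where h = "\<lambda>f. fst (snd f)"])
        fix u v
        assume u: "u \<in> corners G" "(u, v) \<in> walk (arc G) (turn {})"
        then have "v = seg u"
          using 1[OF u(1)] by (simp add: walk_def turn_def)
        then show "v \<in> corners G \<and> (fst (snd u), fst (snd v)) \<in> {}\<^sup>*"
          using u(1) by (cases u) (simp add: mem_corners)
      qed (simp add: C)
      then show False
        by simp
    qed
    moreover have "(?p, ?p') \<in> ?W"
      using 1[of ?p] by (simp add: walk_def C)
    ultimately show thesis
      using that(1) ends one unfolding boundary_rel_eq_walk by blast
  next
    case 2
    have "vtx G ?q = vtx G ?p"
      using 2[of ?p] ribbon_graph_arc(5)[OF G, of ?p] by (simp add: C)
    then have loop: "ends G e = {vtx G ?p}"
      using ends by simp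
    have "orientable_loop G e"
      unfolding orientable_loop_def
    proof (intro conjI exI ballI impI)
      \<comment> \<open>Exclusive or of the two bits: \<open>seg\<close> and \<open>side\<close>
        each negate one bit, and \<open>arc\<close> acts as \<open>side\<close> here.\<close>
      let ?\<omega> = "\<lambda>f. fst (snd f) \<noteq> snd (snd f)"
      show "?\<omega> (arc G f) \<noteq> ?\<omega> f" "?\<omega> (seg f) \<noteq> ?\<omega> f" if "f \<in> corners G" for f
        using 2[OF that] by (cases f; simp)+
      show "?\<omega> (side f) \<noteq> ?\<omega> f" for f
        by (cases f; simp)
    qed (simp add: loop)
    \<comment> \<open>Every step of the walk is \<open>side\<close>, which preserves the second bit;
      its two values are the two boundary circles of the annulus.\<close>
    moreover have "card (corners G // ?R) = card ((\<lambda>f. snd (snd f)) ` corners G)"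
      unfolding quotient_eq_image
    proof (rule card_image_eq_if_same_kernel)
      fix x y
      assume x: "x \<in> corners G" and y: "y \<in> corners G"
      have "(x, y) \<in> ?R \<longleftrightarrow> snd (snd x) = snd (snd y)"
      proof
        assume "(x, y) \<in> ?R"
        then have "y \<in> corners G \<and> (snd (snd x), snd (snd y)) \<in> {}\<^sup>*"
          unfolding boundary_rel_eq_walk
        proof (rule rtrancl_map[where h = "\<lambda>f. snd (snd f)"])
          fix u v
          assume u: "u \<in> corners G" "(u, v) \<in> ?W"
          then have "v = side u"
            using 2[OF u(1)] by (simp add: walk_def turn_def mem_corners e)
          then show "v \<in> corners G \<and> (snd (snd u), snd (snd v)) \<in> {}\<^sup>*"
            using u(1) by (cases u) (simp add: mem_corners)
        qed (use x in simp)
        then show "snd (snd x) = snd (snd y)"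
          by simp
      next
        assume s: "snd (snd x) = snd (snd y)"
        have "y = x \<or> y = side x"
          using x y s by (cases x; cases y) (auto simp: mem_corners e)
        moreover have "(x, side x) \<in> ?W"
          using x by (simp add: walk_def turn_def mem_corners e)
        ultimately show "(x, y) \<in> ?R"
          unfolding boundary_rel_eq_walk by (elim disjE) (simp, simp add: r_into_rtrancl)
      qed
      then show "?R `` {x} = ?R `` {y} \<longleftrightarrow> snd (snd x) = snd (snd y)"
        using boundary_Image_eq_iff[OF G x y] by simp
    qed
    moreover have "(\<lambda>f. snd (snd f)) ` corners G = UNIV"
      by (auto simp: C UNIV_bool)
    ultimately show thesis
      using that(2) loop by simp
  next
    case 3
    have "vtx G ?q' = vtx G ?p"
      using 3[of ?p] ribbon_graph_arc(5)[OF G, of ?p] by (simp add: C)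
    then have loop: "ends G e = {vtx G ?p}"
      using ends ribbon_graph_arc(6)[OF G, of ?q] by (simp add: C)
    have "\<not> orientable_loop G e"
    proof
      assume "orientable_loop G e"
      then obtain \<omega> :: "'e corner \<Rightarrow> bool" where \<omega>: "\<And>f. f \<in> corners G \<Longrightarrow> vtx G f \<in> ends G e \<Longrightarrow> \<omega> (arc G f) \<noteq> \<omega> f \<and> \<omega> (seg f) \<noteq> \<omega> f"
        "\<And>f. f \<in> {e} \<times> UNIV \<Longrightarrow> \<omega> (side f) \<noteq> \<omega> f"
        unfolding orientable_loop_def by blast
      \<comment> \<open>Three corners would carry pairwise different marks, but there are only two
        marks: \<open>arc\<close> joins \<open>?p\<close> to \<open>?q'\<close>, \<open>seg\<close>
        joins \<open>?p\<close> to \<open>?p'\<close>, and \<open>side\<close> joins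
        \<open>?p'\<close> to \<open>?q'\<close>.\<close>
      have "\<omega> ?q' \<noteq> \<omega> ?p" "\<omega> ?p' \<noteq> \<omega> ?p" "\<omega> ?q' \<noteq> \<omega> ?p'"
        using \<omega>(1)[of ?p] \<omega>(2)[of ?p'] 3[of ?p] by (simp_all add: C ends)
      then show False
        by blast
    qed
    then have "nonorientable_loop G e"
      by (simp add: nonorientable_loop_def loop)
    moreover have "(?p, ?p') \<in> ?R"
    proof -
      have "(?p, ?q') \<in> ?W" "(?q', ?p') \<in> ?W"
        using 3[of ?p] by (simp_all add: walk_def turn_def C)
      then show ?thesis
        unfolding boundary_rel_eq_walk by (meson r_into_rtrancl rtrancl_trans)
    qed
    ultimately show thesis
      using that(3) loop one by blast
  qed
qed

text \<open>The value of (1 + |V| - b) / 2 on the graph with one edge of the given type: (1+2-1)/2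
  for the bridges, (1+1-2)/2 for the annulus and (1+1-1)/2 for the Moebius band. Together with
  \<open>type_r1\<close> it distinguishes the four types.\<close>

fun type_rho :: "edge_type \<Rightarrow> rat" where
  "type_rho BS = 1" | "type_rho BP = 1" | "type_rho OL = 0" | "type_rho NL = 1 / 2"

fun type_r1 :: "edge_type \<Rightarrow> rat" where
  "type_r1 BS = 1" | "type_r1 BP = 0" | "type_r1 OL = 0" | "type_r1 NL = 0"

lemma remove_isolated_sel:
  "verts (remove_isolated G) = verts G - isolated G" "edges (remove_isolated G) = edges G"
  "vtx (remove_isolated G) = vtx G" "arc (remove_isolated G) = arc G"
  "classes (remove_isolated G) = (\<lambda>C. C - isolated G) ` classes G - {{}}"
  by (simp_all add: remove_isolated_def)

lemma remove_isolated_loop: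
  "ends (remove_isolated G) e = ends G e"
  "orientable_loop (remove_isolated G) e \<longleftrightarrow> orientable_loop G e"
  "nonorientable_loop (remove_isolated G) e \<longleftrightarrow> nonorientable_loop G e"
  by (simp_all add: ends_def orientable_loop_def nonorientable_loop_def corners_def remove_isolated_sel)

lemma rho_eq:
  "ribbon_graph G \<Longrightarrow>
    rho G A = (of_nat (card A) + of_nat (num_boundary G {}) - of_nat (num_boundary G A)) / 2"
  by (simp add: rho_def num_boundary_empty)

lemma r1_eq:
  "r1 G A = of_nat (num_components (class_graph G) {}) - of_nat (num_components (class_graph G) A)"
  unfolding num_components_empty by (simp add: r1_def graph_rank_def class_graph_def)

text \<open>Isolated vertices cancel in rho and \<open>r1\<close>, so both depend only on the
  matching of the corners and on whether the ends share a class. These are also the data that decide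
  the shape.\<close>

lemma single_edge_shape:
  assumes G: "vc_ribbon_graph G" and e: "edges G = {e}"
  shows "\<exists>i. has_shape (remove_isolated G) i"
    and "has_shape (remove_isolated G) i \<Longrightarrow> rho G {e} = type_rho i \<and> r1 G {e} = type_r1 i"
proof -
  let ?c = "class_of G" and ?H = "remove_isolated G"
  have rG: "ribbon_graph G"
    using G by (simp add: vc_ribbon_graph_def)
  have sub: "ends G e \<subseteq> verts G"
    using ends_subset_verts[OF rG] e by simp
  have iso: "isolated G = verts G - ends G e"
    by (rule single_edge_isolated[OF e])
  have vH: "verts ?H = ends G e"
    using sub by (auto simp: remove_isolated_sel iso)
  have C_sub: "C \<subseteq> verts G" if "C \<in> classes G" for C
    using G that by (auto simp: vc_ribbon_graph_def partition_on_def)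
  \<comment> \<open>After removal only the ends of \<open>e\<close> remain, so the surviving classes
    are the traces of the end classes on \<open>ends G e\<close>.\<close>
  have cH: "classes ?H = (\<lambda>x. ?c x \<inter> ends G e) ` ends G e"
  proof -
    have "C - isolated G = C \<inter> ends G e" if "C \<in> classes G" for C
      using C_sub[OF that] sub unfolding iso by blast
    then have "classes ?H = (\<lambda>C. C \<inter> ends G e) ` classes G - {{}}"
      by (simp add: remove_isolated_sel)
    also have "\<dots> = (\<lambda>x. ?c x \<inter> ends G e) ` ends G e"
    proof (rule subset_antisym)
      show "(\<lambda>C. C \<inter> ends G e) ` classes G - {{}} \<subseteq> (\<lambda>x. ?c x \<inter> ends G e) ` ends G e"
      proof
        fix D
        assume "D \<in> (\<lambda>C. C \<inter> ends G e) ` classes G - {{}}"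
        then obtain C x where "C \<in> classes G" "D = C \<inter> ends G e" "x \<in> C" "x \<in> ends G e"
          by blast
        moreover from this have "?c x = C"
          using class_of_eq[OF G] by blast
        ultimately show "D \<in> (\<lambda>x. ?c x \<inter> ends G e) ` ends G e"
          by blast
      qed
      show "(\<lambda>x. ?c x \<inter> ends G e) ` ends G e \<subseteq> (\<lambda>C. C \<inter> ends G e) ` classes G - {{}}"
        using class_of_mem[OF G] sub by blast
    qed
    finally show ?thesis .
  qed
  have r1: "r1 G {e} = (if ?c u = ?c v then 0 else 1)" if "ends G e = {u, v}" for u v
    using num_components_single[OF G _ _ that] sub that
    by (simp add: r1_eq num_components_empty)
  have rho: "rho G {e} = (1 + of_nat (card (ends G e)) - of_nat (card (corners G // boundary_rel G {e}))) / 2"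
    using single_edge_boundary[OF rG e] by (simp add: rho_eq[OF rG])
  have same: "?c u = ?c v \<longleftrightarrow> v \<in> ?c u" if "u \<in> verts G" "v \<in> verts G" for u v
    using class_of_mem[OF G] class_of_eq[OF G] that by metis
  have "(\<exists>i. has_shape ?H i) \<and> (\<forall>i. has_shape ?H i \<longrightarrow> rho G {e} = type_rho i \<and> r1 G {e} = type_r1 i)"
  proof (cases rule: single_edge_cases[OF rG e])
    case (1 u v)
    have rho1: "rho G {e} = 1"
      using rho 1 by simp
    have uv: "u \<in> verts G" "v \<in> verts G"
      using sub 1 by auto
    have no_loop: "\<not> orientable_loop ?H e" "\<not> nonorientable_loop ?H e"
      using 1 by (simp_all add: orientable_loop_def nonorientable_loop_def remove_isolated_loop)
    have not_loop: "\<not> has_shape ?H OL" "\<not> has_shape ?H NL"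
      using no_loop e by (auto simp: remove_isolated_sel)
    show ?thesis
    proof (cases "?c u = ?c v")
      case True
      then have "classes ?H = {{u, v}}"
        using same[OF uv] same[OF uv(2,1)] class_of_mem[OF G] uv unfolding cH 1 by auto
      then have "has_shape ?H BP" "\<not> has_shape ?H BS"
        using 1 e vH by (auto simp: remove_isolated_sel(2) remove_isolated_loop doubleton_eq_iff)
      then show ?thesis
        using not_loop rho1 r1[OF 1(1)] True by (metis edge_type.exhaust type_r1.simps(2) type_rho.simps(2))
    next
      case False
      then have "classes ?H = {{u}, {v}}"
        using same[OF uv] same[OF uv(2,1)] class_of_mem[OF G] uv unfolding cH 1 by auto
      then have "has_shape ?H BS" "\<not> has_shape ?H BP"
        using 1 e vH by (auto simp: remove_isolated_sel(2) remove_isolated_loop doubleton_eq_iff)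
      then show ?thesis
        using not_loop rho1 r1[OF 1(1)] False by (metis edge_type.exhaust type_r1.simps(1) type_rho.simps(1))
    qed
  next
    case (2 u)
    then have "has_shape ?H OL" "\<not> has_shape ?H BS" "\<not> has_shape ?H BP" "\<not> has_shape ?H NL"
      using e vH by (auto simp: remove_isolated_sel(2) remove_isolated_loop nonorientable_loop_def)
    moreover have "rho G {e} = 0" "r1 G {e} = 0"
      using rho 2 r1[of u u] by simp_all
    ultimately show ?thesis
      by (metis edge_type.exhaust type_r1.simps(3) type_rho.simps(3))
  next
    case (3 u)
    then have "has_shape ?H NL" "\<not> has_shape ?H BS" "\<not> has_shape ?H BP" "\<not> has_shape ?H OL"
      using e vH by (auto simp: remove_isolated_sel(2) remove_isolated_loop nonorientable_loop_def)
    moreover have "rho G {e} = 1 / 2" "r1 G {e} = 0"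
      using rho 3 r1[of u u] by simp_all
    ultimately show ?thesis
      by (metis edge_type.exhaust type_r1.simps(4) type_rho.simps(4))
  qed
  then show "\<exists>i. has_shape ?H i"
    and "has_shape ?H i \<Longrightarrow> rho G {e} = type_rho i \<and> r1 G {e} = type_r1 i"
    by blast+
qed

section \<open>Rank functions of minors and the type of an edge\<close>

lemma rho_delete:
  assumes "ribbon_graph G" "ribbon_graph (delete e G)" "e \<in> edges G" "e \<notin> A"
  shows "rho (delete e G) A = rho G A"
  using assms by (simp add: rho_eq num_boundary_delete)

lemma r1_delete: "r1 (delete e G) A = r1 G A"
  by (simp add: r1_eq num_components_delete)

text \<open>As for matroid contraction: b of the empty set in the minor is b of \<open>{e}\<close>
  in \<open>G\<close>, and this normalisation produces the subtracted term
  \<open>rho G {e}\<close>.\<close>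

lemma rho_contract:
  fixes G :: "('v :: infinite, 'e) vcrg"
  assumes "ribbon_graph G" "ribbon_graph (contract e G)" "e \<in> edges G" "e \<notin> A" "finite A"
  shows "rho (contract e G) A = rho G (insert e A) - rho G {e}"
  using assms by (simp add: rho_eq num_boundary_contract field_simps)

lemma r1_contract:
  fixes G :: "('v :: infinite, 'e) vcrg"
  assumes "vc_ribbon_graph G" "vc_ribbon_graph (contract e G)" "e \<in> edges G" "A \<subseteq> edges G"
  shows "r1 (contract e G) A = r1 G (insert e A) - r1 G {e}"
  using assms by (simp add: r1_eq num_components_contract)

lemma minor_closed_classD:
  assumes "minor_closed_class \<G>" "G \<in> \<G>"
  shows "vc_ribbon_graph G" "ribbon_graph G" "finite (edges G)"
    "e \<in> edges G \<Longrightarrow> delete e G \<in> \<G>" "e \<in> edges G \<Longrightarrow> contract e G \<in> \<G>"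
proof -
  show vc: "vc_ribbon_graph G"
    and "e \<in> edges G \<Longrightarrow> delete e G \<in> \<G>" "e \<in> edges G \<Longrightarrow> contract e G \<in> \<G>"
    using assms unfolding minor_closed_class_def by blast+
  show "ribbon_graph G" "finite (edges G)"
    using vc by (simp_all add: vc_ribbon_graph_def ribbon_graph_def)
qed

text \<open>The resulting parameters depend on the set of deleted edges only, so the arbitrary order
  chosen by \<open>enumeration\<close> has no influence on them. The same is shown for contraction
  below.\<close>

lemma fold_delete:
  assumes \<G>: "minor_closed_class \<G>" and "G \<in> \<G>" "distinct xs" "set xs \<subseteq> edges G"
  shows "fold delete xs G \<in> \<G>" "edges (fold delete xs G) = edges G - set xs"
    "A \<inter> set xs = {} \<Longrightarrow> rho (fold delete xs G) A = rho G A"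
    "r1 (fold delete xs G) A = r1 G A"
proof -
  have "fold delete xs G \<in> \<G> \<and> edges (fold delete xs G) = edges G - set xs \<and>
    (A \<inter> set xs = {} \<longrightarrow> rho (fold delete xs G) A = rho G A) \<and> r1 (fold delete xs G) A = r1 G A"
    using assms(2-)
  proof (induction xs arbitrary: G)
    case (Cons x xs)
    note D = minor_closed_classD[OF \<G>]
    have x: "x \<in> edges G" "delete x G \<in> \<G>" "distinct xs" "set xs \<subseteq> edges (delete x G)"
      using Cons.prems D(4)[of G x] by auto
    then show ?case
      using Cons.IH[OF x(2-4)] D(2)[OF Cons.prems(1)] D(2)[OF x(2)]
      by (auto simp: rho_delete r1_delete)
  qed simp
  then show "fold delete xs G \<in> \<G>" "edges (fold delete xs G) = edges G - set xs"
    "A \<inter> set xs = {} \<Longrightarrow> rho (fold delete xs G) A = rho G A"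
    "r1 (fold delete xs G) A = r1 G A"
    by blast+
qed

lemma fold_contract:
  fixes G :: "('v :: infinite, 'e) vcrg"
  assumes \<G>: "minor_closed_class \<G>" and "G \<in> \<G>" "distinct xs" "set xs \<subseteq> edges G"
  shows "fold contract xs G \<in> \<G>" "edges (fold contract xs G) = edges G - set xs"
    "A \<subseteq> edges G - set xs \<Longrightarrow>
      rho (fold contract xs G) A = rho G (A \<union> set xs) - rho G (set xs) \<and>
      r1 (fold contract xs G) A = r1 G (A \<union> set xs) - r1 G (set xs)"
proof -
  have "fold contract xs G \<in> \<G> \<and> edges (fold contract xs G) = edges G - set xs \<and>
    (A \<subseteq> edges G - set xs \<longrightarrow>
      rho (fold contract xs G) A = rho G (A \<union> set xs) - rho G (set xs) \<and>
      r1 (fold contract xs G) A = r1 G (A \<union> set xs) - r1 G (set xs))"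
    using assms(2-)
  proof (induction xs arbitrary: G)
    case Nil
    then show ?case
      by (simp add: rho_eq[OF minor_closed_classD(2)[OF \<G>]] r1_eq)
  next
    case (Cons x xs)
    note D = minor_closed_classD[OF \<G>]
    have x: "x \<in> edges G" "contract x G \<in> \<G>" "distinct xs" "set xs \<subseteq> edges (contract x G)"
      using Cons.prems D(5)[of G x] by auto
    have ih: "fold contract xs (contract x G) \<in> \<G>"
      "edges (fold contract xs (contract x G)) = edges G - {x} - set xs"
      "A \<subseteq> edges G - {x} - set xs \<Longrightarrow>
        rho (fold contract xs (contract x G)) A =
          rho (contract x G) (A \<union> set xs) - rho (contract x G) (set xs) \<and>
        r1 (fold contract xs (contract x G)) A =
          r1 (contract x G) (A \<union> set xs) - r1 (contract x G) (set xs)"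
      using Cons.IH[OF x(2-4)] by auto
    have c: "rho (contract x G) B = rho G (insert x B) - rho G {x} \<and>
        r1 (contract x G) B = r1 G (insert x B) - r1 G {x}" if "B \<subseteq> edges G - {x}" for B
      using rho_contract[OF D(2)[OF Cons.prems(1)] D(2)[OF x(2)] x(1)]
        r1_contract[OF D(1)[OF Cons.prems(1)] D(1)[OF x(2)] x(1)] that
        finite_subset[OF that] D(3)[OF Cons.prems(1)] by blast
    have "rho (fold contract (x # xs) G) A = rho G (A \<union> set (x # xs)) - rho G (set (x # xs)) \<and>
      r1 (fold contract (x # xs) G) A = r1 G (A \<union> set (x # xs)) - r1 G (set (x # xs))"
      if A: "A \<subseteq> edges G - set (x # xs)"
    proof -
      have "A \<union> set xs \<subseteq> edges G - {x}" "set xs \<subseteq> edges G - {x}"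
        "A \<subseteq> edges G - {x} - set xs"
        using A x(4) by auto
      then show ?thesis
        using c ih(3) by simp
    qed
    then show ?case
      using ih(1,2) by (simp add: set_diff_eq)
  qed
  then show "fold contract xs G \<in> \<G>" "edges (fold contract xs G) = edges G - set xs"
    "A \<subseteq> edges G - set xs \<Longrightarrow>
      rho (fold contract xs G) A = rho G (A \<union> set xs) - rho G (set xs) \<and>
      r1 (fold contract xs G) A = r1 G (A \<union> set xs) - r1 G (set xs)"
    by blast+
qed

lemma enumeration:
  assumes "finite A"
  shows "distinct (enumeration A)" "set (enumeration A) = A"
proof -
  have "\<exists>xs. distinct xs \<and> set xs = A"
    using finite_distinct_list[OF assms] by blast
  then have "distinct (enumeration A) \<and> set (enumeration A) = A"
    unfolding enumeration_def by (rule someI_ex)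
  then show "distinct (enumeration A)" "set (enumeration A) = A"
    by blast+
qed

text \<open>Both minors in \<open>has_type\<close> have \<open>e\<close> as their only edge, so
  \<open>single_edge_shape\<close> applies. For the contraction, the rank of \<open>{e}\<close> is
  that of all edges minus that of the contracted set.\<close>

lemma edge_types:
  fixes G :: "('v :: infinite, 'e) vcrg"
  assumes \<G>: "minor_closed_class \<G>" and G: "G \<in> \<G>" and e: "e \<in> edges G"
  shows ex_type: "\<exists>i j. has_type G e i j"
    and type_values: "has_type G e i j \<Longrightarrow>
      rho G (edges G) - rho G (edges G - {e}) = type_rho i \<and>
      r1 G (edges G) - r1 G (edges G - {e}) = type_r1 i \<and>
      rho G {e} = type_rho j \<and> r1 G {e} = type_r1 j"
proof -
  let ?B = "edges G - {e}"
  note D = minor_closed_classD[OF \<G>]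
  have "finite ?B"
    using D(3)[OF G] by simp
  note x = enumeration[OF this]
  have x_sub: "set (enumeration ?B) \<subseteq> edges G"
    unfolding x(2) by blast
  note d = fold_delete[OF \<G> G x(1) x_sub] and c = fold_contract[OF \<G> G x(1) x_sub]
  have E: "edges G - ?B = {e}" "{e} \<union> ?B = edges G"
    using e by auto
  have ed: "edges (delete_set ?B G) = {e}" and ec: "edges (contract_set ?B G) = {e}"
    using d(2) c(2) unfolding delete_set_def contract_set_def x(2) E .
  have vd: "vc_ribbon_graph (delete_set ?B G)" and vc: "vc_ribbon_graph (contract_set ?B G)"
    using D(1)[OF d(1)] D(1)[OF c(1)] unfolding delete_set_def contract_set_def .
  have "rho (contract_set ?B G) {e} = rho G (edges G) - rho G ?B"
    "r1 (contract_set ?B G) {e} = r1 G (edges G) - r1 G ?B"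
    "rho (delete_set ?B G) {e} = rho G {e}" "r1 (delete_set ?B G) {e} = r1 G {e}"
    using d(3)[of "{e}"] d(4)[of "{e}"] c(3)[of "{e}"] unfolding delete_set_def contract_set_def x(2) E
    by simp_all
  then show "has_type G e i j \<Longrightarrow>
      rho G (edges G) - rho G (edges G - {e}) = type_rho i \<and>
      r1 G (edges G) - r1 G (edges G - {e}) = type_r1 i \<and>
      rho G {e} = type_rho j \<and> r1 G {e} = type_r1 j"
    using single_edge_shape(2)[OF vd ed, of j] single_edge_shape(2)[OF vc ec, of i]
    unfolding has_type_def by simp
  show "\<exists>i j. has_type G e i j"
    using single_edge_shape(1)[OF vd ed] single_edge_shape(1)[OF vc ec]
    unfolding has_type_def by blast
qed

section \<open>Invariance under equivalence\<close>

text \<open>Because \<open>\<phi>\<close> commutes with \<open>seg\<close> and \<open>side\<close>,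
  it maps the four corners of an edge to those of one edge, which defines \<open>\<eta>\<close>.
  Commuting with \<open>arc\<close> then carries boundary walks over, and \<open>\<psi>\<close>
  carries the links between classes over.\<close>

lemma equivalent_edge_bijection:
  fixes G H :: "('v, 'e) vcrg"
  assumes equiv: "vc_ribbon_graph G" "vc_ribbon_graph H" "equivalent G H"
  obtains \<eta> where "bij_betw \<eta> (edges G) (edges H)"
    "\<And>A. A \<subseteq> edges G \<Longrightarrow> num_boundary H (\<eta> ` A) = num_boundary G A"
    "\<And>A. A \<subseteq> edges G \<Longrightarrow>
      num_components (class_graph H) (\<eta> ` A) = num_components (class_graph G) A"
proof -
  have G: "ribbon_graph G" and H: "ribbon_graph H"
    using equiv by (simp_all add: vc_ribbon_graph_def)
  obtain \<phi> \<psi> where \<phi>: "bij_betw \<phi> (corners G) (corners H)" and \<psi>: "bij_betw \<psi> (verts G) (verts H)"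
    and comm: "\<And>f. f \<in> corners G \<Longrightarrow> \<phi> (seg f) = seg (\<phi> f) \<and> \<phi> (side f) = side (\<phi> f) \<and>
      \<phi> (arc G f) = arc H (\<phi> f) \<and> \<psi> (vtx G f) = vtx H (\<phi> f)"
    and cls: "(\<lambda>C. \<psi> ` C) ` classes G = classes H"
    using equiv(3) unfolding equivalent_def by blast
  have \<phi>_inj: "inj_on \<phi> (corners G)" and \<phi>_img: "\<phi> ` corners G = corners H"
    and \<psi>_inj: "inj_on \<psi> (verts G)" and \<psi>_img: "\<psi> ` verts G = verts H"
    using \<phi> \<psi> by (simp_all add: bij_betw_def)
  define \<eta> where "\<eta> e = fst (\<phi> (e, False, False))" for e
  have fst_\<phi>: "fst (\<phi> f) = \<eta> (fst f)" if "f \<in> corners G" for f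
  proof -
    obtain e i s where f: "f = (e, i, s)"
      by (cases f)
    then have e: "(e, j, t) \<in> corners G" for j t
      using that by (simp add: mem_corners)
    have "fst (\<phi> (e, False, True)) = \<eta> e" "fst (\<phi> (e, True, False)) = \<eta> e"
      using comm[OF e[of False False]] by (simp_all add: \<eta>_def)
    moreover from this have "fst (\<phi> (e, True, True)) = \<eta> e"
      using comm[OF e[of True False]] by simp
    ultimately show ?thesis
      by (cases i; cases s) (simp_all add: f \<eta>_def)
  qed
  have edges_eq: "edges K = fst ` corners K" for K :: "('x, 'y) vcrg"
    by (simp add: corners_def)
  have \<eta>_img: "\<eta> ` edges G = edges H"
  proof -
    have "\<eta> ` fst ` corners G = fst ` \<phi> ` corners G"
      unfolding image_image by (rule image_cong[OF refl]) (simp add: fst_\<phi>)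
    then show ?thesis
      by (simp add: edges_eq \<phi>_img)
  qed
  have \<eta>_inj: "inj_on \<eta> (edges G)"
  proof (rule inj_onI)
    fix e e'
    assume e: "e \<in> edges G" "e' \<in> edges G" "\<eta> e = \<eta> e'"
    define f where "f = (e, False, False)"
    define f' where "f' = (e', False, False)"
    have f: "f \<in> corners G" "seg f \<in> corners G" "side f \<in> corners G" "seg (side f) \<in> corners G"
      and f': "f' \<in> corners G"
      using e by (simp_all add: f_def f'_def mem_corners)
    have "fst (\<phi> f') = fst (\<phi> f)"
      using e(3) by (simp add: f_def f'_def \<eta>_def)
    \<comment> \<open>The maps \<open>seg\<close> and \<open>side\<close> reach all four corners of
      an edge, so \<open>\<phi> f'\<close> is the image of a corner of \<open>e\<close>, and
      injectivity of \<open>\<phi>\<close> finishes.\<close>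
    then have "\<phi> f' \<in> {\<phi> f, seg (\<phi> f), side (\<phi> f), seg (side (\<phi> f))}"
      by (cases "\<phi> f"; cases "\<phi> f'") auto
    then have "\<phi> f' \<in> {\<phi> f, \<phi> (seg f), \<phi> (side f), \<phi> (seg (side f))}"
      using comm[OF f(1)] comm[OF f(3)] by simp
    then have "f' \<in> {f, seg f, side f, seg (side f)}"
      using inj_onD[OF \<phi>_inj _ f'] f by simp metis
    then show "e = e'"
      by (simp add: f_def f'_def)
  qed
  have mem: "\<eta> e \<in> \<eta> ` A \<longleftrightarrow> e \<in> A" if "A \<subseteq> edges G" "e \<in> edges G" for A e
    using inj_on_image_mem_iff[OF \<eta>_inj that(2,1)] .

  have "num_boundary H (\<eta> ` A) = num_boundary G A" if A: "A \<subseteq> edges G" for A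
  proof -
    have turn: "\<phi> (turn A f) = turn (\<eta> ` A) (\<phi> f)" if "f \<in> corners G" for f
      using comm[OF that] mem[OF A, of "fst f"] that by (simp add: turn_def fst_\<phi> mem_corners)
    have iff: "(f, g) \<in> boundary_rel G A \<longleftrightarrow> (\<phi> f, \<phi> g) \<in> boundary_rel H (\<eta> ` A)"
      if fg: "f \<in> corners G" "g \<in> corners G" for f g
    proof
      assume "(f, g) \<in> boundary_rel G A"
      then have "g \<in> corners G \<and> (\<phi> f, \<phi> g) \<in> (walk (arc H) (turn (\<eta> ` A)))\<^sup>*"
        unfolding boundary_rel_eq_walk
      proof (rule rtrancl_map)
        fix u v
        assume u: "u \<in> corners G" "(u, v) \<in> walk (arc G) (turn A)"
        then have "(\<phi> u, \<phi> v) \<in> walk (arc H) (turn (\<eta> ` A))"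
          using comm[OF u(1)] turn[OF u(1)] by (simp add: walk_def) metis
        then show "v \<in> corners G \<and> (\<phi> u, \<phi> v) \<in> (walk (arc H) (turn (\<eta> ` A)))\<^sup>*"
          using walk_step[OF G u] by (simp add: r_into_rtrancl)
      qed (rule fg)
      then show "(\<phi> f, \<phi> g) \<in> boundary_rel H (\<eta> ` A)"
        by (simp add: boundary_rel_eq_walk)
    next
      assume "(\<phi> f, \<phi> g) \<in> boundary_rel H (\<eta> ` A)"
      \<comment> \<open>The map \<open>\<phi>\<close> is controlled on \<open>corners G\<close>
        only, so the induction carries a preimage in \<open>corners G\<close> along the walk in
        \<open>H\<close>.\<close>
      moreover have "\<exists>h \<in> corners G. w = \<phi> h \<and> (f, h) \<in> (walk (arc G) (turn A))\<^sup>*"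
        if "(\<phi> f, w) \<in> (walk (arc H) (turn (\<eta> ` A)))\<^sup>*" for w
        using that
      proof (induction rule: rtrancl_induct)
        case base
        then show ?case
          using fg by blast
      next
        case (step w z)
        then obtain h where h: "h \<in> corners G" "w = \<phi> h" "(f, h) \<in> (walk (arc G) (turn A))\<^sup>*"
          by blast
        have "z = \<phi> (arc G h) \<or> z = \<phi> (turn A h)"
          using step(2) comm[OF h(1)] turn[OF h(1)] by (simp add: walk_def h(2))
        then obtain k where k: "z = \<phi> k" "(h, k) \<in> walk (arc G) (turn A)"
          by (metis (mono_tags, lifting) case_prodI mem_Collect_eq walk_def)
        have "k \<in> corners G"
          using walk_step[OF G h(1) k(2)] by simp
        moreover have "(f, k) \<in> (walk (arc G) (turn A))\<^sup>*"
          using h(3) k(2) by (rule rtrancl_into_rtrancl)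
        ultimately show ?case
          using k(1) by (intro bexI[of _ k]) simp_all
      qed
      ultimately obtain h where "h \<in> corners G" "\<phi> g = \<phi> h" "(f, h) \<in> boundary_rel G A"
        unfolding boundary_rel_eq_walk by blast
      then show "(f, g) \<in> boundary_rel G A"
        using inj_onD[OF \<phi>_inj _ fg(2), of h] by simp
    qed
    have "card (corners G // boundary_rel G A) = card ((\<phi> ` corners G) // boundary_rel H (\<eta> ` A))"
    proof (rule card_quotient_eq)
      fix f g
      assume fg: "f \<in> corners G" "g \<in> corners G"
      then have "\<phi> f \<in> corners H" "\<phi> g \<in> corners H"
        using \<phi>_img by blast+
      then show "boundary_rel G A `` {f} = boundary_rel G A `` {g} \<longleftrightarrow>
          boundary_rel H (\<eta> ` A) `` {\<phi> f} = boundary_rel H (\<eta> ` A) `` {\<phi> g}"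
        using iff[OF fg] boundary_Image_eq_iff[OF G fg] boundary_Image_eq_iff[OF H] by simp
    qed
    moreover have "card (isolated H) = card (isolated G)"
    proof -
      have "vtx G ` corners G \<subseteq> verts G"
        using ribbon_graph_arc(4)[OF G] by (rule image_subsetI)
      then have "\<psi> ` isolated G = \<psi> ` verts G - \<psi> ` vtx G ` corners G"
        unfolding isolated_def by (intro inj_on_image_set_diff[OF \<psi>_inj]) simp_all
      also have "\<psi> ` vtx G ` corners G = vtx H ` \<phi> ` corners G"
        unfolding image_image by (rule image_cong[OF refl]) (simp add: comm)
      finally have "isolated H = \<psi> ` isolated G"
        by (simp add: isolated_def \<psi>_img \<phi>_img)
      moreover have "inj_on \<psi> (isolated G)"
        by (rule inj_on_subset[OF \<psi>_inj]) (simp add: isolated_def)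
      ultimately show ?thesis
        by (simp add: card_image)
    qed
    ultimately show ?thesis
      by (simp add: num_boundary_def \<phi>_img)
  qed
  moreover have "num_components (class_graph H) (\<eta> ` A) = num_components (class_graph G) A"
    if A: "A \<subseteq> edges G" for A
  proof -
    have sub: "C \<subseteq> verts G" if "C \<in> classes G" for C
      using equiv(1) that unfolding vc_ribbon_graph_def partition_on_def by blast
    have inj: "x = y" if "x \<in> classes G" "y \<in> classes G" "\<psi> ` x = \<psi> ` y" for x y
      using inj_on_image_eq_iff[OF \<psi>_inj sub sub] that by blast
    have link: "class_of H ` ends H (\<eta> e) = (\<lambda>C. \<psi> ` C) ` class_of G ` ends G e"
      if e: "e \<in> edges G" for e
    proof -
      have "{\<eta> e} \<times> UNIV = \<phi> ` ({e} \<times> UNIV)"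
      proof (rule subset_antisym)
        show "\<phi> ` ({e} \<times> UNIV) \<subseteq> {\<eta> e} \<times> UNIV"
        proof (rule image_subsetI)
          fix f :: "'e corner"
          assume "f \<in> {e} \<times> UNIV"
          then have "fst f = e"
            by (simp add: mem_Times_iff)
          then show "\<phi> f \<in> {\<eta> e} \<times> UNIV"
            using fst_\<phi>[of f] e by (simp add: mem_Times_iff mem_corners)
        qed
        show "{\<eta> e} \<times> UNIV \<subseteq> \<phi> ` ({e} \<times> UNIV)"
        proof
          fix w :: "'e corner"
          assume w: "w \<in> {\<eta> e} \<times> UNIV"
          then have "w \<in> \<phi> ` corners G"
            using e \<eta>_img unfolding \<phi>_img by (auto simp: mem_corners)
          then obtain f where f: "w = \<phi> f" "f \<in> corners G"
            by (rule imageE)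
          then have "\<eta> (fst f) = \<eta> e"
            using fst_\<phi>[of f] w by (simp add: mem_Times_iff)
          then have "fst f = e"
            using inj_onD[OF \<eta>_inj] f(2) e by (simp add: mem_corners)
          then show "w \<in> \<phi> ` ({e} \<times> UNIV)"
            using f(1) by (simp add: mem_Times_iff)
        qed
      qed
      then have "class_of H ` ends H (\<eta> e) = (\<lambda>f. class_of H (vtx H (\<phi> f))) ` ({e} \<times> UNIV)"
        by (simp add: ends_def image_image)
      also have "\<dots> = (\<lambda>f. \<psi> ` class_of G (vtx G f)) ` ({e} \<times> UNIV)"
      proof (rule image_cong[OF refl])
        fix f :: "'e corner"
        assume "f \<in> {e} \<times> UNIV"
        then have f: "f \<in> corners G"
          using e by (simp add: mem_corners mem_Times_iff)
        note c = class_of_mem[OF equiv(1) ribbon_graph_arc(4)[OF G f]]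
        show "class_of H (vtx H (\<phi> f)) = \<psi> ` class_of G (vtx G f)"
        proof (rule class_of_eq[OF equiv(2)])
          show "\<psi> ` class_of G (vtx G f) \<in> classes H"
            using c(1) cls by blast
          have "\<psi> (vtx G f) = vtx H (\<phi> f)"
            using comm[OF f] by simp
          then show "vtx H (\<phi> f) \<in> \<psi> ` class_of G (vtx G f)"
            using c(2) by (metis imageI)
        qed
      qed
      finally show ?thesis
        by (simp add: ends_def image_image)
    qed
    have "(x, y) \<in> (class_links G A)\<^sup>* \<longleftrightarrow> (\<psi> ` x, \<psi> ` y) \<in> (class_links H (\<eta> ` A))\<^sup>*"
      if xy: "x \<in> classes G" "y \<in> classes G" for x y
    proof
      assume "(x, y) \<in> (class_links G A)\<^sup>*"
      then have "y \<in> UNIV \<and> (\<psi> ` x, \<psi> ` y) \<in> (class_links H (\<eta> ` A))\<^sup>*"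
      proof (rule rtrancl_map)
        fix u v
        assume "(u, v) \<in> class_links G A"
        then obtain e where e: "e \<in> A" "class_of G ` ends G e = {u, v}"
          unfolding class_links_def by blast
        then have "class_of H ` ends H (\<eta> e) = {\<psi> ` u, \<psi> ` v}"
          using link[OF subsetD[OF A e(1)]] by simp
        then have "(\<psi> ` u, \<psi> ` v) \<in> class_links H (\<eta> ` A)"
          using e(1) unfolding class_links_def by blast
        then show "v \<in> UNIV \<and> (\<psi> ` u, \<psi> ` v) \<in> (class_links H (\<eta> ` A))\<^sup>*"
          by (simp add: r_into_rtrancl)
      qed simp
      then show "(\<psi> ` x, \<psi> ` y) \<in> (class_links H (\<eta> ` A))\<^sup>*" ..
    next
      assume "(\<psi> ` x, \<psi> ` y) \<in> (class_links H (\<eta> ` A))\<^sup>*"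
      moreover have "\<exists>z \<in> classes G. w = \<psi> ` z \<and> (x, z) \<in> (class_links G A)\<^sup>*"
        if "(\<psi> ` x, w) \<in> (class_links H (\<eta> ` A))\<^sup>*" for w
        using that
      proof (induction rule: rtrancl_induct)
        case base
        then show ?case
          using xy by blast
      next
        case (step w z)
        then obtain y where y: "y \<in> classes G" "w = \<psi> ` y" "(x, y) \<in> (class_links G A)\<^sup>*"
          by blast
        obtain e where e: "e \<in> A" "class_of H ` ends H (\<eta> e) = {w, z}"
          using step(2) unfolding class_links_def by blast
        have eE: "e \<in> edges G"
          using A e(1) by blast
        obtain p0 q0 where "ends G e = {p0, q0}"
          using ends_eq[OF G eE] by blast
        then have pq0: "class_of G ` ends G e = {class_of G p0, class_of G q0}"
          "class_of G p0 \<in> classes G" "class_of G q0 \<in> classes G"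
          using ends_subset_verts[OF G eE] class_of_mem(1)[OF equiv(1)] by simp_all
        have "{\<psi> ` class_of G p0, \<psi> ` class_of G q0} = {w, z}"
          using e(2) link[OF eE] unfolding pq0 by simp
        then obtain p q where pq: "class_of G ` ends G e = {p, q}" "p \<in> classes G" "q \<in> classes G"
          "\<psi> ` p = w" "\<psi> ` q = z"
          using pq0 by (metis doubleton_eq_iff)
        have "p = y"
          using inj pq(2,4) y(1,2) by blast
        then have "(y, q) \<in> class_links G A"
          using e(1) pq(1) unfolding class_links_def by blast
        with y(3) have "(x, q) \<in> (class_links G A)\<^sup>*"
          by (rule rtrancl_into_rtrancl)
        then show ?case
          using pq(3,5) by blast
      qed
      ultimately obtain z where "z \<in> classes G" "\<psi> ` y = \<psi> ` z" "(x, z) \<in> (class_links G A)\<^sup>*"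
        by blast
      then show "(x, y) \<in> (class_links G A)\<^sup>*"
        using inj xy(2) by metis
    qed
    then show ?thesis
      using num_components_eq[OF cls] by metis
  qed
  ultimately show thesis
    using that \<eta>_img \<eta>_inj by (simp add: bij_betw_def)
qed

section \<open>The state sum\<close>

lemma finite_var: "finite (UNIV :: var set)"
proof -
  have "(UNIV :: var set) = {Alpha, Gamma, A_bs, A_bp, A_ol, B_bs, B_bp, B_ol}"
    by (auto intro: var.exhaust)
  then show ?thesis
    by (metis finite.simps)
qed

text \<open>As \<open>var\<close> is finite, every function to the rationals is an exponent vector.
  Products and rational powers become pointwise operations, and identities of monomials are checked
  one variable at a time.\<close>

definition monomial :: "(var \<Rightarrow> rat) \<Rightarrow> laurent" where
  "monomial h = Poly_Mapping.single (Abs_poly_mapping h) 1"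

lemma lookup_Abs_var: "Poly_Mapping.lookup (Abs_poly_mapping h) = (h :: var \<Rightarrow> rat)"
  by (rule lookup_Abs_poly_mapping) (rule finite_subset[OF subset_UNIV finite_var])

lemma monomial_mult: "monomial h * monomial k = monomial (\<lambda>x. h x + k x)"
proof -
  have "Abs_poly_mapping h + Abs_poly_mapping k = Abs_poly_mapping (\<lambda>x. h x + k x)"
    by (rule poly_mapping_eqI) (simp add: lookup_add lookup_Abs_var)
  then show ?thesis
    by (simp add: monomial_def mult_single)
qed

lemma monomial_1: "monomial (\<lambda>x. 0) = 1"
proof -
  have "Abs_poly_mapping (\<lambda>x. 0) = (0 :: var \<Rightarrow>\<^sub>0 rat)"
    by (rule poly_mapping_eqI) (simp add: lookup_Abs_var)
  then show ?thesis
    by (simp add: monomial_def)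
qed

lemma monomial_power: "monomial h ^ n = monomial (\<lambda>x. of_nat n * h x)"
  by (induction n) (simp_all add: monomial_1 monomial_mult algebra_simps)

lemma monomial_powq: "monomial h powq q = monomial (\<lambda>x. q * h x)"
proof -
  have "Poly_Mapping.map ((*) q) (Abs_poly_mapping h) = Abs_poly_mapping (\<lambda>x. q * h x)"
    by (rule poly_mapping_eqI) (simp add: map.rep_eq lookup_Abs_var when_def)
  then show ?thesis
    by (simp add: monomial_def mpow_def)
qed

lemma X_monomial: "X v = monomial (\<lambda>x. if x = v then 1 else 0)"
proof -
  have "Poly_Mapping.single v 1 = Abs_poly_mapping (\<lambda>x. if x = v then 1 else 0 :: rat)"
    by (rule poly_mapping_eqI) (simp add: lookup_single lookup_Abs_var when_def)
  then show ?thesis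
    by (simp add: monomial_def X_def)
qed

lemmas monomial_simps = X_monomial monomial_power monomial_powq monomial_mult mdivide_def

text \<open>A formula uniform in the type: for \<open>NL\<close> the value \<open>type_rho\<close> =
  1/2 puts exponent 1/2 on both \<open>A_bp\<close> and \<open>A_ol\<close>, which is the prescribed
  a_nl.\<close>

definition acoeff_exp :: "edge_type \<Rightarrow> var \<Rightarrow> rat" where
  "acoeff_exp i x = (case x of A_bs \<Rightarrow> type_r1 i | A_bp \<Rightarrow> type_rho i - type_r1 i
    | A_ol \<Rightarrow> 1 - type_rho i | _ \<Rightarrow> 0)"

definition bcoeff_exp :: "edge_type \<Rightarrow> var \<Rightarrow> rat" where
  "bcoeff_exp i x = (case x of B_bs \<Rightarrow> type_r1 i | B_bp \<Rightarrow> type_rho i - type_r1 i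
    | B_ol \<Rightarrow> 1 - type_rho i | _ \<Rightarrow> 0)"

lemma acoeff_monomial: "acoeff i = monomial (acoeff_exp i)"
  by (cases i; simp add: monomial_simps;
      intro arg_cong[of _ _ monomial] ext; simp add: acoeff_exp_def split: var.split)

lemma bcoeff_monomial: "bcoeff i = monomial (bcoeff_exp i)"
  by (cases i; simp add: monomial_simps;
      intro arg_cong[of _ _ monomial] ext; simp add: bcoeff_exp_def split: var.split)

text \<open>The exponents of the a and b variables are complementary: for bs, bp and ol they add up
  to r1(E), r2(E) and |E| - rho(E), independently of \<open>A\<close>.\<close>

definition state_exp :: "('v, 'e) vcrg \<Rightarrow> 'e set \<Rightarrow> var \<Rightarrow> rat" where
  "state_exp G A x = (case x of
      Alpha \<Rightarrow> of_nat (num_components (class_graph G) A)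
    | Gamma \<Rightarrow> of_nat (num_boundary G A)
    | A_bs \<Rightarrow> r1 G (edges G) - r1 G A
    | A_bp \<Rightarrow> r2 G (edges G) - r2 G A
    | A_ol \<Rightarrow> of_nat (card (edges G)) - rho G (edges G) - (of_nat (card A) - rho G A)
    | B_bs \<Rightarrow> r1 G A
    | B_bp \<Rightarrow> r2 G A
    | B_ol \<Rightarrow> of_nat (card A) - rho G A)"

lemma state_sum_monomial: "state_sum G = (\<Sum>A \<in> Pow (edges G). monomial (state_exp G A))"
proof -
  \<comment> \<open>Since r1 + r2 = rho, the terms with E cancel and leave |V| + |A| - 2 rho(A),
    which is b(A) by the definition of rho.\<close>
  have "v - rhoE + (r1E - r1A + (r2E - r2A + (a - rhoA))) = b"
    if "2 * rhoA = a + v - b" "r2E = rhoE - r1E" "r2A = rhoA - r1A" for v rhoE r1E r1A r2E r2A a rhoA b :: rat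
    using that by simp
  then have gamma: "of_nat (card (verts G)) - rho G (edges G) + (r1 G (edges G) - r1 G A +
      (r2 G (edges G) - r2 G A + (of_nat (card A) - rho G A))) = of_nat (num_boundary G A)" for A
    by (simp add: rho_def r2_def)
  show ?thesis
    unfolding state_sum_def Let_def sum_distrib_left
    apply (rule sum.cong[OF refl])
    apply (simp add: monomial_simps)
    apply (intro arg_cong[of _ _ monomial] ext)
    subgoal for A x
      using gamma[of A] by (cases x) (simp_all add: state_exp_def r1_eq algebra_simps)
    done
qed

section \<open>Membership in the coefficient ring and the edgeless case\<close>

lemma monomial_coeff_ring:
  assumes "\<And>x. x \<in> {Alpha, Gamma, A_bs, B_bs} \<Longrightarrow> h x \<in> \<nat>"
    and "\<And>x. x \<in> {A_bp, A_ol, B_bp, B_ol} \<Longrightarrow> 2 * h x \<in> \<nat>"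
  shows "monomial h \<in> coeff_ring"
  using assms by (simp add: coeff_ring_def monomial_def lookup_Abs_var)

lemma coeff_ring_add:
  assumes "p \<in> coeff_ring" "q \<in> coeff_ring"
  shows "p + q \<in> coeff_ring"
  using assms Poly_Mapping.keys_add[of p q] unfolding coeff_ring_def by blast

lemma coeff_ring_mult:
  assumes "p \<in> coeff_ring" "q \<in> coeff_ring"
  shows "p * q \<in> coeff_ring"
  unfolding coeff_ring_def
proof (intro CollectI ballI)
  fix m
  assume "m \<in> Poly_Mapping.keys (p * q)"
  then obtain a b where ab: "m = a + b" "a \<in> Poly_Mapping.keys p" "b \<in> Poly_Mapping.keys q"
    using keys_mult[of p q] by blast
  have "Poly_Mapping.lookup a x \<in> \<nat> \<and> Poly_Mapping.lookup b x \<in> \<nat>" if "x \<in> {Alpha, Gamma, A_bs, B_bs}" for x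
    using assms ab(2,3) that unfolding coeff_ring_def by blast
  moreover have "2 * Poly_Mapping.lookup a x \<in> \<nat> \<and> 2 * Poly_Mapping.lookup b x \<in> \<nat>"
    if "x \<in> {A_bp, A_ol, B_bp, B_ol}" for x
    using assms ab(2,3) that unfolding coeff_ring_def by blast
  ultimately show "(\<forall>x \<in> {Alpha, Gamma, A_bs, B_bs}. Poly_Mapping.lookup m x \<in> \<nat>) \<and>
      (\<forall>x \<in> {A_bp, A_ol, B_bp, B_ol}. 2 * Poly_Mapping.lookup m x \<in> \<nat>)"
    by (simp add: ab(1) lookup_add distrib_left)
qed

lemma coeff_in_ring: "acoeff i \<in> coeff_ring" "bcoeff i \<in> coeff_ring"
  unfolding acoeff_monomial bcoeff_monomial
  by (rule monomial_coeff_ring; cases i; auto simp: acoeff_exp_def bcoeff_exp_def)+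

lemma edgeless_monomial:
  "X Alpha ^ n * X Gamma ^ m = monomial (\<lambda>x. case x of Alpha \<Rightarrow> of_nat n | Gamma \<Rightarrow> of_nat m | _ \<Rightarrow> 0)"
  unfolding monomial_simps
  by (intro arg_cong[of _ _ monomial] ext) (simp split: var.split)

lemma state_sum_edgeless:
  assumes G: "ribbon_graph G" and "edges G = {}"
  shows "state_sum G = X Alpha ^ card (classes G) * X Gamma ^ card (verts G)"
proof -
  have "rho G {} = 0" "r1 G {} = 0"
    by (simp_all add: rho_eq[OF G] r1_eq)
  then have "state_exp G {} x = (case x of Alpha \<Rightarrow> of_nat (card (classes G))
      | Gamma \<Rightarrow> of_nat (card (verts G)) | _ \<Rightarrow> 0)" for x
    by (cases x) (simp_all add: state_exp_def assms(2) num_components_empty num_boundary_empty[OF G] r2_def)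
  then have "monomial (state_exp G {}) = X Alpha ^ card (classes G) * X Gamma ^ card (verts G)"
    unfolding edgeless_monomial by (intro arg_cong[of _ _ monomial] ext)
  then show ?thesis
    by (simp add: state_sum_monomial assms(2))
qed

section \<open>Recursion, invariance and uniqueness\<close>

text \<open>For a set avoiding e, all parameters of \<open>A\<close> itself agree in the two graphs.
  Only |E|, rho(E) and r1(E) change; they occur only in the exponents of the a variables, and by
  \<open>type_values\<close> their increments give \<open>acoeff_exp i\<close>.\<close>

lemma state_exp_delete:
  fixes G :: "('v :: infinite, 'e) vcrg"
  assumes \<G>: "minor_closed_class \<G>" "G \<in> \<G>" and e: "e \<in> edges G" and type: "has_type G e i j"
    and A: "A \<subseteq> edges G - {e}"
  shows "state_exp G A = (\<lambda>x. acoeff_exp i x + state_exp (delete e G) A x)"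
proof
  fix x
  note D = minor_closed_classD[OF \<G>(1)]
  have G: "ribbon_graph G" and H: "ribbon_graph (delete e G)"
    using D(2,4) \<G>(2) e by blast+
  have "e \<notin> A"
    using A by blast
  note rho = rho_delete[OF G H e]
  have "of_nat (card (edges G)) = (of_nat (card (edges G - {e})) + 1 :: rat)"
    using card_Suc_Diff1[OF D(3)[OF \<G>(2)] e] by (metis of_nat_Suc add.commute)
  then show "state_exp G A x = acoeff_exp i x + state_exp (delete e G) A x"
    using type_values[OF \<G> e type] rho[OF \<open>e \<notin> A\<close>] rho[of "edges G - {e}"]
      num_boundary_delete[OF G H e \<open>e \<notin> A\<close>]
    by (cases x) (simp_all add: state_exp_def acoeff_exp_def r2_def r1_delete num_components_delete)
qed

text \<open>Dual to deletion: the differences between E and the set, hence the exponents of the a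
  variables, are unchanged. The exponents of the b variables drop by the values at
  \<open>{e}\<close>, which give \<open>bcoeff_exp j\<close>.\<close>

lemma state_exp_contract:
  fixes G :: "('v :: infinite, 'e) vcrg"
  assumes \<G>: "minor_closed_class \<G>" "G \<in> \<G>" and e: "e \<in> edges G" and type: "has_type G e i j"
    and A: "A \<subseteq> edges G - {e}"
  shows "state_exp G (insert e A) = (\<lambda>x. bcoeff_exp j x + state_exp (contract e G) A x)"
proof
  fix x
  note D = minor_closed_classD[OF \<G>(1)]
  have G: "vc_ribbon_graph G" "ribbon_graph G" and H: "vc_ribbon_graph (contract e G)" "ribbon_graph (contract e G)"
    using D(1,2,5) \<G>(2) e by blast+
  have A': "e \<notin> A" "A \<subseteq> edges G" "finite A" "edges G - {e} \<subseteq> edges G" "finite (edges G - {e})"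
    using A e D(3)[OF \<G>(2)] finite_subset by blast+
  have "of_nat (card (edges G)) = (of_nat (card (edges G - {e})) + 1 :: rat)"
    using card_Suc_Diff1[OF D(3)[OF \<G>(2)] e] by (metis of_nat_Suc add.commute)
  then show "state_exp G (insert e A) x = bcoeff_exp j x + state_exp (contract e G) A x"
    using type_values[OF \<G> e type]
      rho_contract[OF G(2) H(2) e A'(1,3)] rho_contract[OF G(2) H(2) e _ A'(5)]
      r1_contract[OF G(1) H(1) e A'(2)] r1_contract[OF G(1) H(1) e A'(4)]
      num_boundary_contract[OF G(2) H(2) e A'(1)] num_components_contract[OF G(1) H(1) e A'(2)] A'(1,3)
    by (cases x) (simp_all add: state_exp_def bcoeff_exp_def r2_def insert_absorb[OF e])
qed

lemma sum_Pow_remove: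
  assumes "finite E" "e \<in> E"
  shows "(\<Sum>A \<in> Pow E. f A) = (\<Sum>A \<in> Pow (E - {e}). f A) + (\<Sum>A \<in> Pow (E - {e}). f (insert e A))"
proof -
  have "Pow E = Pow (E - {e}) \<union> insert e ` Pow (E - {e})"
    using Pow_insert[of e "E - {e}"] assms(2) by (simp add: insert_absorb)
  moreover have "Pow (E - {e}) \<inter> insert e ` Pow (E - {e}) = {}"
    by auto
  moreover have "inj_on (insert e) (Pow (E - {e}))"
    by (auto simp: inj_on_def)
  ultimately show ?thesis
    using assms(1) by (simp add: sum.union_disjoint sum.reindex)
qed

lemma state_sum_deletion_contraction:
  fixes G :: "('v :: infinite, 'e) vcrg"
  assumes \<G>: "minor_closed_class \<G>" "G \<in> \<G>" and e: "e \<in> edges G" and type: "has_type G e i j"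
  shows "state_sum G = acoeff i * state_sum (delete e G) + bcoeff j * state_sum (contract e G)"
  unfolding state_sum_monomial acoeff_monomial bcoeff_monomial sum_distrib_left monomial_mult
    sum_Pow_remove[OF minor_closed_classD(3)[OF \<G>] e] delete_sel(2) contract_sel(2)
  by (intro arg_cong2[of _ _ _ _ "(+)"] sum.cong refl arg_cong[of _ _ monomial])
     (simp_all add: state_exp_delete[OF assms] state_exp_contract[OF assms])

text \<open>Since every edge has a type, the recursion is available at any edge of a graph that has
  one. This induction serves both the range of the state sum and uniqueness.\<close>

lemma minor_induct [consumes 2, case_names edgeless minor]:
  fixes G :: "('v :: infinite, 'e) vcrg"
  assumes \<G>: "minor_closed_class \<G>" and G: "G \<in> \<G>"
    and edgeless: "\<And>G. G \<in> \<G> \<Longrightarrow> edges G = {} \<Longrightarrow> P G"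
    and minor: "\<And>G e i j. G \<in> \<G> \<Longrightarrow> e \<in> edges G \<Longrightarrow> has_type G e i j \<Longrightarrow> delete e G \<in> \<G> \<Longrightarrow>
      contract e G \<in> \<G> \<Longrightarrow> P (delete e G) \<Longrightarrow> P (contract e G) \<Longrightarrow> P G"
  shows "P G"
  using G
proof (induction "card (edges G)" arbitrary: G rule: less_induct)
  case less
  note D = minor_closed_classD[OF \<G> less.prems]
  show ?case
  proof (cases "edges G = {}")
    case True
    then show ?thesis
      by (rule edgeless[OF less.prems])
  next
    case False
    then obtain e where e: "e \<in> edges G"
      by blast
    then obtain i j where "has_type G e i j"
      using ex_type[OF \<G> less.prems] by blast
    moreover have "card (edges G - {e}) < card (edges G)"
      using card_Diff1_less[OF D(3) e] .
    ultimately show ?thesis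
      using minor[OF less.prems e] less.hyps D(4,5)[OF e] by simp
  qed
qed

text \<open>All exponents are functions of |A|, b and k, which \<open>\<eta>\<close> preserves; the
  sum is reindexed along \<open>\<eta>\<close>.\<close>

lemma state_sum_equivalent:
  assumes G: "vc_ribbon_graph G" and H: "vc_ribbon_graph H" and equiv: "equivalent G H"
  shows "state_sum G = state_sum H"
proof -
  obtain \<eta> where \<eta>: "bij_betw \<eta> (edges G) (edges H)"
    and nb: "\<And>A. A \<subseteq> edges G \<Longrightarrow> num_boundary H (\<eta> ` A) = num_boundary G A"
    and nc: "\<And>A. A \<subseteq> edges G \<Longrightarrow>
      num_components (class_graph H) (\<eta> ` A) = num_components (class_graph G) A"
    using equivalent_edge_bijection[OF assms] by blast
  have inj: "inj_on \<eta> (edges G)" and img: "\<eta> ` edges G = edges H"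
    using \<eta> by (simp_all add: bij_betw_def)
  have rG: "ribbon_graph G" and rH: "ribbon_graph H"
    using G H by (simp_all add: vc_ribbon_graph_def)
  have c: "card (\<eta> ` A) = card A" if "A \<subseteq> edges G" for A
    using card_image[OF inj_on_subset[OF inj that]] .
  have r: "rho H (\<eta> ` A) = rho G A" "r1 H (\<eta> ` A) = r1 G A" if "A \<subseteq> edges G" for A
    using nb[of "{}"] nc[of "{}"] nb[OF that] nc[OF that] c[OF that]
    by (simp_all add: rho_eq[OF rG] rho_eq[OF rH] r1_eq)
  have exp: "state_exp H (\<eta> ` A) = state_exp G A" if "A \<subseteq> edges G" for A
  proof
    fix x
    show "state_exp H (\<eta> ` A) x = state_exp G A x"
      using r[OF that] r[OF order_refl] c[OF that] c[OF order_refl] nb[OF that] nc[OF that]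
      unfolding img by (cases x) (simp_all add: state_exp_def r2_def)
  qed
  have "inj_on ((`) \<eta>) (Pow (edges G))"
    by (rule inj_on_image_Pow[OF inj])
  moreover have "Pow (edges H) = (`) \<eta> ` Pow (edges G)"
    by (simp add: image_Pow_surj[OF img])
  ultimately show ?thesis
    by (simp add: state_sum_monomial sum.reindex exp)
qed

text \<open>Reading this off the exponents would require integrality, monotonicity and sign
  properties of the rank functions. The recursion instead builds the sum from edgeless graphs and
  coefficients that visibly lie in the ring.\<close>

lemma state_sum_coeff_ring:
  fixes G :: "('v :: infinite, 'e) vcrg"
  assumes \<G>: "minor_closed_class \<G>" and G: "G \<in> \<G>"
  shows "state_sum G \<in> coeff_ring"
  using assms
proof (induction rule: minor_induct)
  case (edgeless G)
  have "X Alpha ^ n * X Gamma ^ m \<in> coeff_ring" for n m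
    unfolding edgeless_monomial by (rule monomial_coeff_ring) auto
  then show ?case
    using state_sum_edgeless[OF minor_closed_classD(2)[OF \<G> edgeless(1)] edgeless(2)] by simp
next
  case (minor G e i j)
  then show ?case
    using state_sum_deletion_contraction[OF \<G> minor(1-3)]
    by (simp add: coeff_ring_add coeff_ring_mult coeff_in_ring)
qed

lemma deletion_contraction_map_state_sum:
  fixes \<G> :: "('v :: infinite, 'e) vcrg set"
  assumes \<G>: "minor_closed_class \<G>"
  shows "deletion_contraction_map \<G> (restrict state_sum \<G>)"
  unfolding deletion_contraction_map_def
proof (intro conjI ballI allI impI)
  note D = minor_closed_classD[OF \<G>]
  show "restrict state_sum \<G> \<in> \<G> \<rightarrow>\<^sub>E coeff_ring"
    using state_sum_coeff_ring[OF \<G>] by simp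
  show "restrict state_sum \<G> G = restrict state_sum \<G> H"
    if "G \<in> \<G>" "H \<in> \<G>" "equivalent G H" for G H
    using state_sum_equivalent[OF D(1)[OF that(1)] D(1)[OF that(2)] that(3)] that by simp
  show "restrict state_sum \<G> G =
      acoeff i * restrict state_sum \<G> (delete e G) + bcoeff j * restrict state_sum \<G> (contract e G)"
    if "G \<in> \<G>" "e \<in> edges G" "has_type G e i j" for G e i j
    using state_sum_deletion_contraction[OF \<G> that] D(4,5)[OF that(1,2)] that(1) by simp
  show "restrict state_sum \<G> G = X Alpha ^ card (classes G) * X Gamma ^ card (verts G)"
    if "G \<in> \<G>" "edges G = {}" for G
    using state_sum_edgeless[OF D(2)[OF that(1)] that(2)] that(1) by simp
qed

lemma deletion_contraction_map_unique:
  fixes \<G> :: "('v :: infinite, 'e) vcrg set"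
  assumes \<G>: "minor_closed_class \<G>" and U: "deletion_contraction_map \<G> U" and G: "G \<in> \<G>"
  shows "U G = state_sum G"
  using \<G> G
proof (induction rule: minor_induct)
  case (edgeless G)
  then show ?case
    using state_sum_edgeless[OF minor_closed_classD(2)[OF \<G> edgeless(1)] edgeless(2)] U
    by (simp add: deletion_contraction_map_def)
next
  case (minor G e i j)
  have "U G = acoeff i * U (delete e G) + bcoeff j * U (contract e G)"
    using U minor(1-3) unfolding deletion_contraction_map_def by blast
  then show ?case
    using state_sum_deletion_contraction[OF \<G> minor(1-3)] minor(6,7) by simp
qed

theorem theorem4p8:
  fixes \<G> :: "('v :: infinite, 'e) vcrg set"
  assumes "minor_closed_class \<G>"
  shows "(\<exists>!U. deletion_contraction_map \<G> U) \<and>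
    (\<forall>U. deletion_contraction_map \<G> U \<longrightarrow> (\<forall>G \<in> \<G>. U G = state_sum G))"
proof (intro conjI allI impI ballI)
  show "\<exists>!U. deletion_contraction_map \<G> U"
  proof (rule ex1I)
    show "deletion_contraction_map \<G> (restrict state_sum \<G>)"
      by (rule deletion_contraction_map_state_sum[OF assms])
    fix U
    assume U: "deletion_contraction_map \<G> U"
    then have "U \<in> \<G> \<rightarrow>\<^sub>E coeff_ring"
      by (simp add: deletion_contraction_map_def)
    then show "U = restrict state_sum \<G>"
      using deletion_contraction_map_unique[OF assms U]
      by (intro extensionalityI[of _ \<G>]) (simp_all add: PiE_def)
  qed
qed (rule deletion_contraction_map_unique[OF assms])

end
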